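(* Let $G$ be a discrete group, $H$ a normal subgroup of $G$, $K=G/H$, $\sigma\in Z^2(G,\mathbb{T})$, and let $\sigma'$ be the restriction of $\sigma$ to $H\times H$. Assume that $(G,H,\sigma)$ satisfies the relative Kleppner condition. Then the automorphism $\gamma_k$ of $W^*(H,\sigma')$ is freely acting for every $k\in G\setminus H$. Moreover, the twisted action $(\beta,\omega)$ of $K$ on $W^*(H,\sigma')$ is freely acting.
   Context: For a discrete group $G$ with identity $e$, $Z^2(G,\mathbb{T})$ is the set of normalized 2-cocycles, i.e. maps $\sigma:G\times G\to\mathbb{T}$ with $\sigma(g,e)=\sigma(e,g)=1$ and $\sigma(g,h)\sigma(gh,k)=\sigma(h,k)\sigma(g,hk)$ for all $g,h,k$. With $(\lambda_\sigma(g)\xi)(h)=\sigma(g,g^{-1}h)\xi(g^{-1}h)$ on $\ell^2(G)$, $W^*(G,\sigma)$ is the von Neumann algebra generated by $\lambda_\sigma(G)$. Let $H$ be normal in $G$. $W^*(H,\sigma')$ is identified with the von Neumann subalgebra of $W^*(G,\sigma)$ generated by $\lambda_\sigma(H)$, via $\lambda_{\sigma'}(h)\mapsto\lambda_\sigma(h)$. For $g\in G$, conjugation by $\lambda_\sigma(g)$ restricts to a $*$-automorphism $\gamma_g$ of $W^*(H,\sigma')$, which satisfies $\gamma_g(\lambda_{\sigma'}(h))=\sigma(g,h)\overline{\sigma(ghg^{-1},g)}\,\lambda_{\sigma'}(ghg^{-1})$ for $h\in H$. Fix a section $s:K\to G$ for the quotient map with $s(e)=e$. Put $m(k,l)=s(k)s(l)s(kl)^{-1}\in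 H$, $\beta_k=\gamma_{s(k)}$ and $\omega(k,l)=\sigma(s(k),s(l))\overline{\sigma(m(k,l),s(kl))}\lambda_{\sigma'}(m(k,l))$ for $k,l\in K$; $(\beta,\omega)$ is a twisted action (cocycle crossed action) of $K$ on $W^*(H,\sigma')$. An automorphism $\alpha$ of a von Neumann algebra $M$ is freely acting if the only $T\in M$ satisfying $\alpha(S)T=TS$ for all $S\in M$ is $T=0$. A twisted action $(\beta,\omega)$ of $K$ on $M$ is freely acting if $\beta_k$ is freely acting for every $k\in K\setminus\{e\}$. For $g\in G$ let $C_H(g)=\{sgs^{-1}:s\in H\}$. An element $g\in G$ is $\sigma$-regular w.r.t. $H$ if $\sigma(g,s)=\sigma(s,g)$ whenever $s\in H$ commutes with $g$; then every element of $C_H(g)$ is $\sigma$-regular w.r.t. $H$ and $C_H(g)$ is called $\sigma$-regular. $(G,H,\sigma)$ satisfies the relative Kleppner condition if $|C_H(g)|=\infty$ whenever $g\in G\setminus H$ and $C_H(g)$ is $\sigma$-regular. *)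

theory Defs
  imports "HOL-Analysis.Infinite_Sum" "HOL-Algebra.Coset"
begin

section \<open>Bounded operators on square-summable functions\<close>

text \<open>The Hilbert space of square-summable functions on a set \<open>A\<close>; functions are extended
  by zero outside \<open>A\<close>, so that equality of vectors is equality of functions.\<close>

definition ell2 :: "'a set \<Rightarrow> ('a \<Rightarrow> complex) set" where
  "ell2 A = {\<xi>. (\<forall>x. x \<notin> A \<longrightarrow> \<xi> x = 0) \<and> (\<lambda>x. (cmod (\<xi> x))\<^sup>2) summable_on A}"

definition ell2_inner :: "'a set \<Rightarrow> ('a \<Rightarrow> complex) \<Rightarrow> ('a \<Rightarrow> complex) \<Rightarrow> complex" where
  "ell2_inner A \<xi> \<eta> = (\<Sum>\<^sub>\<infinity>x\<in>A. \<xi> x * cnj (\<eta> x))"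

definition ell2_norm :: "'a set \<Rightarrow> ('a \<Rightarrow> complex) \<Rightarrow> real" where
  "ell2_norm A \<xi> = sqrt (\<Sum>\<^sub>\<infinity>x\<in>A. (cmod (\<xi> x))\<^sup>2)"

type_synonym 'a operator = "('a \<Rightarrow> complex) \<Rightarrow> ('a \<Rightarrow> complex)"

text \<open>Operators are \<open>undefined\<close> outside the Hilbert space (membership in \<open>\<rightarrow>\<^sub>E\<close>), so that two
  operators are equal as functions iff they agree on the Hilbert space.\<close>

definition bounded_ops :: "'a set \<Rightarrow> 'a operator set" where
  "bounded_ops A = {T \<in> ell2 A \<rightarrow>\<^sub>E ell2 A.
     (\<forall>\<xi>\<in>ell2 A. \<forall>\<eta>\<in>ell2 A. T (\<lambda>x. \<xi> x + \<eta> x) = (\<lambda>x. T \<xi> x + T \<eta> x)) \<and>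
     (\<forall>c. \<forall>\<xi>\<in>ell2 A. T (\<lambda>x. c * \<xi> x) = (\<lambda>x. c * T \<xi> x)) \<and>
     (\<exists>C. \<forall>\<xi>\<in>ell2 A. ell2_norm A (T \<xi>) \<le> C * ell2_norm A \<xi>)}"

definition op_zero :: "'a set \<Rightarrow> 'a operator" where
  "op_zero A = (\<lambda>\<xi>\<in>ell2 A. \<lambda>x. 0)"

definition op_one :: "'a set \<Rightarrow> 'a operator" where
  "op_one A = (\<lambda>\<xi>\<in>ell2 A. \<xi>)"

definition op_add :: "'a set \<Rightarrow> 'a operator \<Rightarrow> 'a operator \<Rightarrow> 'a operator" where
  "op_add A S T = (\<lambda>\<xi>\<in>ell2 A. \<lambda>x. S \<xi> x + T \<xi> x)"

definition op_scale :: "'a set \<Rightarrow> complex \<Rightarrow> 'a operator \<Rightarrow> 'a operator" where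
  "op_scale A c T = (\<lambda>\<xi>\<in>ell2 A. \<lambda>x. c * T \<xi> x)"

definition op_mult :: "'a set \<Rightarrow> 'a operator \<Rightarrow> 'a operator \<Rightarrow> 'a operator" where
  "op_mult A S T = compose (ell2 A) S T"

definition op_adjoint :: "'a set \<Rightarrow> 'a operator \<Rightarrow> 'a operator" where
  "op_adjoint A T = (THE T'. T' \<in> bounded_ops A \<and>
     (\<forall>\<xi>\<in>ell2 A. \<forall>\<eta>\<in>ell2 A. ell2_inner A (T \<xi>) \<eta> = ell2_inner A \<xi> (T' \<eta>)))"

section \<open>Von Neumann algebras\<close>

definition commutant :: "'a set \<Rightarrow> 'a operator set \<Rightarrow> 'a operator set" where
  "commutant A M = {T \<in> bounded_ops A. \<forall>S\<in>M. op_mult A S T = op_mult A T S}"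

definition von_neumann_algebra :: "'a set \<Rightarrow> 'a operator set \<Rightarrow> bool" where
  "von_neumann_algebra A M \<longleftrightarrow> M \<subseteq> bounded_ops A \<and> (\<forall>T\<in>M. op_adjoint A T \<in> M) \<and>
     commutant A (commutant A M) = M"

definition vN_generated :: "'a set \<Rightarrow> 'a operator set \<Rightarrow> 'a operator set" where
  "vN_generated A X = \<Inter> {M. von_neumann_algebra A M \<and> X \<subseteq> M}"

definition vN_automorphism :: "'a set \<Rightarrow> 'a operator set \<Rightarrow> ('a operator \<Rightarrow> 'a operator) \<Rightarrow> bool" where
  "vN_automorphism A M \<alpha> \<longleftrightarrow> bij_betw \<alpha> M M \<and>
     (\<forall>S\<in>M. \<forall>T\<in>M. \<alpha> (op_add A S T) = op_add A (\<alpha> S) (\<alpha> T)) \<and>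
     (\<forall>c. \<forall>T\<in>M. \<alpha> (op_scale A c T) = op_scale A c (\<alpha> T)) \<and>
     (\<forall>S\<in>M. \<forall>T\<in>M. \<alpha> (op_mult A S T) = op_mult A (\<alpha> S) (\<alpha> T)) \<and>
     (\<forall>T\<in>M. \<alpha> (op_adjoint A T) = op_adjoint A (\<alpha> T))"

definition vN_unitary :: "'a set \<Rightarrow> 'a operator set \<Rightarrow> 'a operator \<Rightarrow> bool" where
  "vN_unitary A M U \<longleftrightarrow> U \<in> M \<and>
     op_mult A (op_adjoint A U) U = op_one A \<and> op_mult A U (op_adjoint A U) = op_one A"

definition op_conj :: "'a set \<Rightarrow> 'a operator \<Rightarrow> 'a operator \<Rightarrow> 'a operator" where
  "op_conj A U T = op_mult A (op_mult A U T) (op_adjoint A U)"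

definition freely_acting :: "'a set \<Rightarrow> 'a operator set \<Rightarrow> ('a operator \<Rightarrow> 'a operator) \<Rightarrow> bool" where
  "freely_acting A M \<alpha> \<longleftrightarrow> vN_automorphism A M \<alpha> \<and>
     (\<forall>T\<in>M. (\<forall>S\<in>M. op_mult A (\<alpha> S) T = op_mult A T S) \<longrightarrow> T = op_zero A)"

definition twisted_action :: "('k, 'm) monoid_scheme \<Rightarrow> 'a set \<Rightarrow> 'a operator set \<Rightarrow>
    ('k \<Rightarrow> 'a operator \<Rightarrow> 'a operator) \<Rightarrow> ('k \<Rightarrow> 'k \<Rightarrow> 'a operator) \<Rightarrow> bool" where
  "twisted_action K A M \<beta> \<omega> \<longleftrightarrow>
     (\<forall>k\<in>carrier K. vN_automorphism A M (\<beta> k)) \<and>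
     (\<forall>k\<in>carrier K. \<forall>l\<in>carrier K. vN_unitary A M (\<omega> k l)) \<and>
     (\<forall>k\<in>carrier K. \<forall>l\<in>carrier K. \<forall>T\<in>M.
        \<beta> k (\<beta> l T) = op_conj A (\<omega> k l) (\<beta> (k \<otimes>\<^bsub>K\<^esub> l) T)) \<and>
     (\<forall>k\<in>carrier K. \<forall>l\<in>carrier K. \<forall>j\<in>carrier K.
        op_mult A (\<omega> k l) (\<omega> (k \<otimes>\<^bsub>K\<^esub> l) j) = op_mult A (\<beta> k (\<omega> l j)) (\<omega> k (l \<otimes>\<^bsub>K\<^esub> j))) \<and>
     (\<forall>k\<in>carrier K. \<omega> k \<one>\<^bsub>K\<^esub> = op_one A \<and> \<omega> \<one>\<^bsub>K\<^esub> k = op_one A)"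

definition freely_acting_twisted :: "('k, 'm) monoid_scheme \<Rightarrow> 'a set \<Rightarrow> 'a operator set \<Rightarrow>
    ('k \<Rightarrow> 'a operator \<Rightarrow> 'a operator) \<Rightarrow> ('k \<Rightarrow> 'k \<Rightarrow> 'a operator) \<Rightarrow> bool" where
  "freely_acting_twisted K A M \<beta> \<omega> \<longleftrightarrow> twisted_action K A M \<beta> \<omega> \<and>
     (\<forall>k\<in>carrier K - {\<one>\<^bsub>K\<^esub>}. freely_acting A M (\<beta> k))"

section \<open>Twisted group von Neumann algebras\<close>

definition cocycles :: "('a, 'b) monoid_scheme \<Rightarrow> ('a \<Rightarrow> 'a \<Rightarrow> complex) set" where
  "cocycles G = {\<sigma>.
     (\<forall>g\<in>carrier G. \<forall>h\<in>carrier G. cmod (\<sigma> g h) = 1) \<and>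
     (\<forall>g\<in>carrier G. \<sigma> g \<one>\<^bsub>G\<^esub> = 1 \<and> \<sigma> \<one>\<^bsub>G\<^esub> g = 1) \<and>
     (\<forall>g\<in>carrier G. \<forall>h\<in>carrier G. \<forall>k\<in>carrier G.
        \<sigma> g h * \<sigma> (g \<otimes>\<^bsub>G\<^esub> h) k = \<sigma> h k * \<sigma> g (h \<otimes>\<^bsub>G\<^esub> k))}"

definition twisted_regular ::
    "('a, 'b) monoid_scheme \<Rightarrow> ('a \<Rightarrow> 'a \<Rightarrow> complex) \<Rightarrow> 'a \<Rightarrow> 'a operator" where
  "twisted_regular G \<sigma> g = (\<lambda>\<xi>\<in>ell2 (carrier G). \<lambda>h.
     if h \<in> carrier G then \<sigma> g (inv\<^bsub>G\<^esub> g \<otimes>\<^bsub>G\<^esub> h) * \<xi> (inv\<^bsub>G\<^esub> g \<otimes>\<^bsub>G\<^esub> h) else 0)"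

text \<open>For a subgroup \<open>H\<close> of \<open>G\<close> this is the von Neumann algebra of \<open>H\<close> twisted by the
  restriction of \<open>\<sigma>\<close>, identified with the von Neumann subalgebra of the twisted group von Neumann
  algebra of \<open>G\<close> that is generated by the image of \<open>H\<close>; it acts on the square-summable functions
  on \<open>G\<close>. For \<open>H = carrier G\<close> it is the twisted group von Neumann algebra of \<open>G\<close> itself.\<close>

definition twisted_vN :: "('a, 'b) monoid_scheme \<Rightarrow> 'a set \<Rightarrow> ('a \<Rightarrow> 'a \<Rightarrow> complex) \<Rightarrow> 'a operator set" where
  "twisted_vN G H \<sigma> = vN_generated (carrier G) (twisted_regular G \<sigma> ` H)"

definition gamma_aut :: "('a, 'b) monoid_scheme \<Rightarrow> 'a set \<Rightarrow> ('a \<Rightarrow> 'a \<Rightarrow> complex) \<Rightarrow>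
    'a \<Rightarrow> 'a operator \<Rightarrow> 'a operator" where
  "gamma_aut G H \<sigma> g = (\<lambda>T\<in>twisted_vN G H \<sigma>. op_conj (carrier G) (twisted_regular G \<sigma> g) T)"

text \<open>An element of \<open>G Mod H\<close> is a coset, and the quotient map sends each of its elements to it;
  hence sections are exactly the choice functions below.\<close>

definition normalized_section :: "('a, 'b) monoid_scheme \<Rightarrow> 'a set \<Rightarrow> ('a set \<Rightarrow> 'a) \<Rightarrow> bool" where
  "normalized_section G H s \<longleftrightarrow>
     (\<forall>k\<in>carrier (G Mod H). s k \<in> carrier G \<and> H #>\<^bsub>G\<^esub> s k = k) \<and> s \<one>\<^bsub>G Mod H\<^esub> = \<one>\<^bsub>G\<^esub>"

definition section_defect :: "('a, 'b) monoid_scheme \<Rightarrow> 'a set \<Rightarrow> ('a set \<Rightarrow> 'a) \<Rightarrow>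
    'a set \<Rightarrow> 'a set \<Rightarrow> 'a" where
  "section_defect G H s k l = s k \<otimes>\<^bsub>G\<^esub> s l \<otimes>\<^bsub>G\<^esub> inv\<^bsub>G\<^esub> (s (k \<otimes>\<^bsub>G Mod H\<^esub> l))"

definition quotient_beta :: "('a, 'b) monoid_scheme \<Rightarrow> 'a set \<Rightarrow> ('a \<Rightarrow> 'a \<Rightarrow> complex) \<Rightarrow>
    ('a set \<Rightarrow> 'a) \<Rightarrow> 'a set \<Rightarrow> 'a operator \<Rightarrow> 'a operator" where
  "quotient_beta G H \<sigma> s k = gamma_aut G H \<sigma> (s k)"

definition quotient_omega :: "('a, 'b) monoid_scheme \<Rightarrow> 'a set \<Rightarrow> ('a \<Rightarrow> 'a \<Rightarrow> complex) \<Rightarrow>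
    ('a set \<Rightarrow> 'a) \<Rightarrow> 'a set \<Rightarrow> 'a set \<Rightarrow> 'a operator" where
  "quotient_omega G H \<sigma> s k l = op_scale (carrier G)
     (\<sigma> (s k) (s l) * cnj (\<sigma> (section_defect G H s k l) (s (k \<otimes>\<^bsub>G Mod H\<^esub> l))))
     (twisted_regular G \<sigma> (section_defect G H s k l))"

section \<open>The relative Kleppner condition\<close>

definition rel_conj_class :: "('a, 'b) monoid_scheme \<Rightarrow> 'a set \<Rightarrow> 'a \<Rightarrow> 'a set" where
  "rel_conj_class G H g = {s \<otimes>\<^bsub>G\<^esub> g \<otimes>\<^bsub>G\<^esub> inv\<^bsub>G\<^esub> s | s. s \<in> H}"

definition sigma_regular :: "('a, 'b) monoid_scheme \<Rightarrow> 'a set \<Rightarrow> ('a \<Rightarrow> 'a \<Rightarrow> complex) \<Rightarrow> 'a \<Rightarrow> bool" where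
  "sigma_regular G H \<sigma> g \<longleftrightarrow> (\<forall>s\<in>H. s \<otimes>\<^bsub>G\<^esub> g = g \<otimes>\<^bsub>G\<^esub> s \<longrightarrow> \<sigma> g s = \<sigma> s g)"

text \<open>Regularity is constant on each class \<open>rel_conj_class G H g\<close>, and the class is called regular
  when its elements are; so the condition may be tested on the representative \<open>g\<close>.\<close>

definition relative_kleppner :: "('a, 'b) monoid_scheme \<Rightarrow> 'a set \<Rightarrow> ('a \<Rightarrow> 'a \<Rightarrow> complex) \<Rightarrow> bool" where
  "relative_kleppner G H \<sigma> \<longleftrightarrow>
     (\<forall>g\<in>carrier G - H. sigma_regular G H \<sigma> g \<longrightarrow> infinite (rel_conj_class G H g))"

end

theory Submission
  imports Defs "HOL-Analysis.L2_Norm"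
begin

text \<open>
  Let \<open>M\<close> be the algebra of \<open>H\<close>, acting on the square-summable functions on \<open>G\<close>, let \<open>k \<notin> H\<close>, and
  suppose that \<open>T \<in> M\<close> intertwines the identity with conjugation by the left translation \<open>lam k\<close>.
  Then \<open>V\<close>, the product of the adjoint of \<open>lam k\<close> with \<open>T\<close>, commutes with the left translations by \<open>H\<close>.
  Like every operator built from left translations it also commutes with the twisted right
  translations \<open>rho s\<close>.  Since \<open>lam s\<close> and \<open>rho s\<close> both map the point mass at \<open>\<one>\<close> to the point mass at
  \<open>s\<close>, the vector \<open>v = V (delta \<one>)\<close> satisfies \<open>lam s v = rho s v\<close> for \<open>s \<in> H\<close>, that is,
  \<open>\<sigma> s x * v x = \<sigma> (s x s\<^sup>-\<^sup>1) s * v (s x s\<^sup>-\<^sup>1)\<close>.  So \<open>v\<close> vanishes at elements that are not regular,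
  and has constant absolute value on each class; as it is square-summable, it vanishes on the infinite
  classes.  By the relative Kleppner condition nothing is left outside \<open>H\<close>
  (\<open>twisted_class_function_vanishes\<close>), while on \<open>H\<close> the vector \<open>v\<close> vanishes because
  \<open>T (delta \<one>)\<close> is supported in \<open>H\<close> and \<open>v\<close> is supported in \<open>k\<^sup>-\<^sup>1 H\<close>.  Hence \<open>T (delta \<one>) = 0\<close>, and \<open>T = 0\<close>
  because \<open>delta \<one>\<close> is separating for \<open>M\<close> (\<open>gamma_freely_acting\<close>).

  That \<open>T\<close> commutes with right translations and preserves the functions supported in \<open>H\<close> is seen by
  identifying \<open>M\<close> with the double commutant of the left translations by \<open>H\<close>
  (\<open>vN_generated_eq_double_commutant\<close>).  This identification needs adjoints of arbitrary bounded
  operators, which are constructed from matrix coefficients (\<open>adjoint_exists\<close>).  It also gives that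
  conjugation by \<open>lam g\<close> is an automorphism of \<open>M\<close>, since it permutes the generators up to scalars.

  For the quotient, the one identity \<open>\<omega> k l \<cdot> lam (s (k l)) = lam (s k) \<cdot> lam (s l)\<close> (\<open>omega_lam\<close>)
  carries both axioms relating \<open>\<beta>\<close> and \<open>\<omega>\<close>, and freeness is the first part applied to
  \<open>s k\<close>, which lies outside \<open>H\<close> for every \<open>k\<close> other than the identity coset.
\<close>

section \<open>Square-summable functions\<close>

lemma ell2I:
  assumes "\<And>x. x \<notin> A \<Longrightarrow> \<xi> x = 0" and "(\<lambda>x. (cmod (\<xi> x))\<^sup>2) summable_on A"
  shows "\<xi> \<in> ell2 A"
  using assms by (simp add: ell2_def)

lemma ell2_outside: "\<xi> \<in> ell2 A \<Longrightarrow> x \<notin> A \<Longrightarrow> \<xi> x = 0"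
  by (simp add: ell2_def)

lemma ell2_summable: "\<xi> \<in> ell2 A \<Longrightarrow> (\<lambda>x. (cmod (\<xi> x))\<^sup>2) summable_on A"
  by (simp add: ell2_def)

lemma ell2_eqI:
  assumes "\<xi> \<in> ell2 A" "\<eta> \<in> ell2 A" "\<And>x. x \<in> A \<Longrightarrow> \<xi> x = \<eta> x"
  shows "\<xi> = \<eta>"
  using assms ell2_outside by (metis ext)

lemma ell2_dominated:
  assumes "f summable_on A" and "\<And>x. x \<in> A \<Longrightarrow> (cmod (\<xi> x))\<^sup>2 \<le> f x"
    and "\<And>x. x \<notin> A \<Longrightarrow> \<xi> x = 0"
  shows "\<xi> \<in> ell2 A"
  by (rule ell2I[OF assms(3)])
    (use summable_on_comparison_test[OF assms(1), of "\<lambda>x. (cmod (\<xi> x))\<^sup>2"] assms(2) in auto)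

lemma ell2_zero: "(\<lambda>x. 0) \<in> ell2 A"
  by (rule ell2I) auto

lemma ell2_scale: "\<xi> \<in> ell2 A \<Longrightarrow> (\<lambda>x. c * \<xi> x) \<in> ell2 A"
  by (rule ell2I)
    (auto simp: ell2_outside norm_mult power_mult_distrib intro: summable_on_cmult_right ell2_summable)

lemma ell2_add:
  assumes "\<xi> \<in> ell2 A" "\<eta> \<in> ell2 A"
  shows "(\<lambda>x. \<xi> x + \<eta> x) \<in> ell2 A"
proof (rule ell2_dominated)
  show "(\<lambda>x. 2 * (cmod (\<xi> x))\<^sup>2 + 2 * (cmod (\<eta> x))\<^sup>2) summable_on A"
    by (intro summable_on_add summable_on_cmult_right ell2_summable assms)
  fix x
  have "(cmod (\<xi> x + \<eta> x))\<^sup>2 \<le> (cmod (\<xi> x) + cmod (\<eta> x))\<^sup>2"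
    by (intro power_mono norm_triangle_ineq) auto
  also have "\<dots> \<le> 2 * (cmod (\<xi> x))\<^sup>2 + 2 * (cmod (\<eta> x))\<^sup>2"
    using sum_squares_bound[of "cmod (\<xi> x)" "cmod (\<eta> x)"] by (simp add: power2_sum)
  finally show "(cmod (\<xi> x + \<eta> x))\<^sup>2 \<le> 2 * (cmod (\<xi> x))\<^sup>2 + 2 * (cmod (\<eta> x))\<^sup>2" .
qed (use assms in \<open>auto simp: ell2_outside\<close>)

definition truncation :: "'a set \<Rightarrow> ('a \<Rightarrow> complex) \<Rightarrow> 'a \<Rightarrow> complex" where
  "truncation F \<xi> = (\<lambda>x. if x \<in> F then \<xi> x else 0)"

definition delta :: "'a \<Rightarrow> 'a \<Rightarrow> complex" where
  "delta x = (\<lambda>y. if y = x then 1 else 0)"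

lemma ell2_truncation: "\<xi> \<in> ell2 A \<Longrightarrow> truncation F \<xi> \<in> ell2 A"
  by (rule ell2_dominated[OF ell2_summable]) (auto simp: truncation_def ell2_outside)

lemma ell2_finite_support:
  assumes "finite F" "F \<subseteq> A" shows "truncation F \<xi> \<in> ell2 A"
proof (rule ell2I)
  have "(\<lambda>x. (cmod (truncation F \<xi> x))\<^sup>2) summable_on A \<longleftrightarrow> (\<lambda>x. (cmod (truncation F \<xi> x))\<^sup>2) summable_on F"
    by (rule summable_on_cong_neutral) (use assms in \<open>auto simp: truncation_def\<close>)
  then show "(\<lambda>x. (cmod (truncation F \<xi> x))\<^sup>2) summable_on A"
    using assms by simp
qed (use assms in \<open>auto simp: truncation_def\<close>)

lemma ell2_delta: "x \<in> A \<Longrightarrow> delta x \<in> ell2 A"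
  using ell2_finite_support[of "{x}" A "\<lambda>_. 1"] by (simp add: delta_def truncation_def)

lemma ell2_norm_nonneg: "0 \<le> ell2_norm A \<xi>"
  by (simp add: ell2_norm_def infsum_nonneg)

lemma ell2_norm_sq: "(ell2_norm A \<xi>)\<^sup>2 = (\<Sum>\<^sub>\<infinity>x\<in>A. (cmod (\<xi> x))\<^sup>2)"
  by (simp add: ell2_norm_def infsum_nonneg)

lemma L2_set_le_ell2_norm:
  assumes "\<xi> \<in> ell2 A" "finite F" "F \<subseteq> A"
  shows "L2_set (\<lambda>x. cmod (\<xi> x)) F \<le> ell2_norm A \<xi>"
  unfolding L2_set_def ell2_norm_def
  by (rule real_sqrt_le_mono, rule finite_sum_le_infsum) (use assms in \<open>auto intro: ell2_summable\<close>)

lemma ell2_product_summable: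
  assumes "\<xi> \<in> ell2 A" "\<eta> \<in> ell2 A"
  shows "(\<lambda>x. \<xi> x * cnj (\<eta> x)) abs_summable_on A"
proof (rule summable_on_comparison_test)
  show "(\<lambda>x. (cmod (\<xi> x))\<^sup>2 + (cmod (\<eta> x))\<^sup>2) summable_on A"
    by (intro summable_on_add ell2_summable assms)
  fix x
  show "norm (\<xi> x * cnj (\<eta> x)) \<le> (cmod (\<xi> x))\<^sup>2 + (cmod (\<eta> x))\<^sup>2"
    using sum_squares_bound[of "cmod (\<xi> x)" "cmod (\<eta> x)"] 
      mult_nonneg_nonneg[OF norm_ge_zero[of "\<xi> x"] norm_ge_zero[of "\<eta> x"]]
    unfolding norm_mult complex_mod_cnj by linarith
qed auto

lemma ell2_product_summable':
  assumes "\<xi> \<in> ell2 A" "\<eta> \<in> ell2 A"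
  shows "(\<lambda>x. \<xi> x * cnj (\<eta> x)) summable_on A"
  using abs_summable_summable[OF ell2_product_summable[OF assms]] .

lemma ell2_Cauchy_Schwarz:
  assumes "\<xi> \<in> ell2 A" "\<eta> \<in> ell2 A"
  shows "cmod (ell2_inner A \<xi> \<eta>) \<le> ell2_norm A \<xi> * ell2_norm A \<eta>"
proof -
  have "cmod (ell2_inner A \<xi> \<eta>) \<le> (\<Sum>\<^sub>\<infinity>x\<in>A. cmod (\<xi> x * cnj (\<eta> x)))"
    unfolding ell2_inner_def by (rule norm_infsum_bound[OF ell2_product_summable[OF assms]])
  also have "\<dots> \<le> ell2_norm A \<xi> * ell2_norm A \<eta>"
  proof (rule infsum_le_finite_sums[OF ell2_product_summable[OF assms]])
    fix F assume F: "finite F" "F \<subseteq> A"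
    have "(\<Sum>x\<in>F. norm (\<xi> x * cnj (\<eta> x))) 
        \<le> L2_set (\<lambda>x. cmod (\<xi> x)) F * L2_set (\<lambda>x. cmod (\<eta> x)) F"
      using L2_set_mult_ineq[of "\<lambda>x. cmod (\<xi> x)" "\<lambda>x. cmod (\<eta> x)" F] by (simp add: norm_mult)
    also have "\<dots> \<le> ell2_norm A \<xi> * ell2_norm A \<eta>"
      by (intro mult_mono L2_set_le_ell2_norm assms F) (auto simp: ell2_norm_nonneg)
    finally show "(\<Sum>x\<in>F. norm (\<xi> x * cnj (\<eta> x))) \<le> ell2_norm A \<xi> * ell2_norm A \<eta>" .
  qed
  finally show ?thesis .
qed

lemma ell2_inner_add_left:
  assumes "\<xi> \<in> ell2 A" "\<xi>' \<in> ell2 A" "\<eta> \<in> ell2 A"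
  shows "ell2_inner A (\<lambda>x. \<xi> x + \<xi>' x) \<eta> = ell2_inner A \<xi> \<eta> + ell2_inner A \<xi>' \<eta>"
  unfolding ell2_inner_def
  by (simp add: distrib_right infsum_add ell2_product_summable' assms)

lemma ell2_inner_scale_left:
  "ell2_inner A (\<lambda>x. c * \<xi> x) \<eta> = c * ell2_inner A \<xi> \<eta>"
  unfolding ell2_inner_def
  by (simp add: mult.assoc infsum_cmult_right')

lemma ell2_inner_commute: "ell2_inner A \<xi> \<eta> = cnj (ell2_inner A \<eta> \<xi>)"
  unfolding ell2_inner_def by (simp add: mult.commute flip: infsum_cnj)

lemma ell2_inner_scale_right:
  "ell2_inner A \<xi> (\<lambda>x. c * \<eta> x) = cnj c * ell2_inner A \<xi> \<eta>"
  by (subst (1 2) ell2_inner_commute) (simp add: ell2_inner_scale_left)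

lemma ell2_inner_self: 
  "\<xi> \<in> ell2 A \<Longrightarrow> ell2_inner A \<xi> \<xi> = complex_of_real ((ell2_norm A \<xi>)\<^sup>2)"
  unfolding ell2_inner_def ell2_norm_sq complex_norm_square[symmetric]
  by (intro infsumI has_sum_of_real has_sum_infsum ell2_summable)

lemma ell2_inner_delta_right:
  assumes "\<xi> \<in> ell2 A" shows "ell2_inner A \<xi> (delta x) = \<xi> x"
proof -
  have "ell2_inner A \<xi> (delta x) = (\<Sum>\<^sub>\<infinity>y\<in>A \<inter> {x}. \<xi> y)"
    unfolding ell2_inner_def by (rule infsum_cong_neutral) (auto simp: delta_def)
  also have "\<dots> = \<xi> x"
    by (cases "x \<in> A") (use assms in \<open>auto simp: ell2_outside\<close>)
  finally show ?thesis .
qed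

section \<open>Bounded operators and their matrix coefficients\<close>

lemma bounded_op_extensional: "T \<in> bounded_ops A \<Longrightarrow> T \<in> extensional (ell2 A)"
  by (simp add: bounded_ops_def PiE_def)

lemma bounded_op_in: "T \<in> bounded_ops A \<Longrightarrow> \<xi> \<in> ell2 A \<Longrightarrow> T \<xi> \<in> ell2 A"
  by (auto simp: bounded_ops_def)

lemma bounded_op_add: 
  "T \<in> bounded_ops A \<Longrightarrow> \<xi> \<in> ell2 A \<Longrightarrow> \<eta> \<in> ell2 A \<Longrightarrow> T (\<lambda>x. \<xi> x + \<eta> x) = (\<lambda>x. T \<xi> x + T \<eta> x)"
  by (auto simp: bounded_ops_def)

lemma bounded_op_scale: 
  "T \<in> bounded_ops A \<Longrightarrow> \<xi> \<in> ell2 A \<Longrightarrow> T (\<lambda>x. c * \<xi> x) = (\<lambda>x. c * T \<xi> x)"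
  by (auto simp: bounded_ops_def)

lemma bounded_op_bound:
  assumes "T \<in> bounded_ops A"
  obtains C where "C \<ge> 0" "\<And>\<xi>. \<xi> \<in> ell2 A \<Longrightarrow> ell2_norm A (T \<xi>) \<le> C * ell2_norm A \<xi>"
proof -
  obtain C where C: "\<forall>\<xi>\<in>ell2 A. ell2_norm A (T \<xi>) \<le> C * ell2_norm A \<xi>"
    using assms by (auto simp: bounded_ops_def)
  show thesis
  proof (rule that[of "max C 0"])
    fix \<xi> assume "\<xi> \<in> ell2 A"
    then have "ell2_norm A (T \<xi>) \<le> C * ell2_norm A \<xi>" using C by blast
    also have "\<dots> \<le> max C 0 * ell2_norm A \<xi>"
      by (intro mult_right_mono ell2_norm_nonneg) auto
    finally show "ell2_norm A (T \<xi>) \<le> max C 0 * ell2_norm A \<xi>" .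
  qed auto
qed

lemma bounded_opI:
  assumes "T \<in> extensional (ell2 A)" "\<And>\<xi>. \<xi> \<in> ell2 A \<Longrightarrow> T \<xi> \<in> ell2 A"
    and "\<And>\<xi> \<eta>. \<xi> \<in> ell2 A \<Longrightarrow> \<eta> \<in> ell2 A \<Longrightarrow> T (\<lambda>x. \<xi> x + \<eta> x) = (\<lambda>x. T \<xi> x + T \<eta> x)"
    and "\<And>c \<xi>. \<xi> \<in> ell2 A \<Longrightarrow> T (\<lambda>x. c * \<xi> x) = (\<lambda>x. c * T \<xi> x)"
    and "\<And>\<xi>. \<xi> \<in> ell2 A \<Longrightarrow> ell2_norm A (T \<xi>) \<le> C * ell2_norm A \<xi>"
  shows "T \<in> bounded_ops A"
  using assms unfolding bounded_ops_def PiE_def by blast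

lemma op_eqI:
  assumes "S \<in> bounded_ops A" "T \<in> bounded_ops A" "\<And>\<xi>. \<xi> \<in> ell2 A \<Longrightarrow> S \<xi> = T \<xi>"
  shows "S = T"
  using extensionalityI[OF bounded_op_extensional bounded_op_extensional] assms by blast

lemma op_eq_innerI:
  assumes "S \<in> bounded_ops A" "T \<in> bounded_ops A" 
    and "\<And>\<xi> \<eta>. \<xi> \<in> ell2 A \<Longrightarrow> \<eta> \<in> ell2 A \<Longrightarrow> ell2_inner A (S \<xi>) \<eta> = ell2_inner A (T \<xi>) \<eta>"
  shows "S = T"
proof (rule op_eqI[OF assms(1,2)], rule ext)
  fix \<xi> x assume \<xi>: "\<xi> \<in> ell2 A"
  then have in_ell2: "S \<xi> \<in> ell2 A" "T \<xi> \<in> ell2 A"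
    using assms(1,2) by (auto intro: bounded_op_in)
  show "S \<xi> x = T \<xi> x"
  proof (cases "x \<in> A")
    case True
    with assms(3)[OF \<xi> ell2_delta[OF True]] show ?thesis
      by (simp add: ell2_inner_delta_right in_ell2)
  qed (use in_ell2 in \<open>simp add: ell2_outside\<close>)
qed

lemma ell2_norm_truncation_complement_tendsto:
  assumes "\<xi> \<in> ell2 A"
  shows "((\<lambda>F. ell2_norm A (truncation (- F) \<xi>)) \<longlongrightarrow> 0) (finite_subsets_at_top A)"
proof -
  let ?f = "\<lambda>x. (cmod (\<xi> x))\<^sup>2"
  have "(sum ?f \<longlongrightarrow> infsum ?f A) (finite_subsets_at_top A)"
    using infsum_tendsto[OF ell2_summable[OF assms]] .
  then have "((\<lambda>F. sqrt (infsum ?f A - sum ?f F)) \<longlongrightarrow> sqrt (infsum ?f A - infsum ?f A)) (finite_subsets_at_top A)"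
    by (intro tendsto_intros)
  moreover have "\<forall>\<^sub>F F in finite_subsets_at_top A. 
      sqrt (infsum ?f A - sum ?f F) = ell2_norm A (truncation (- F) \<xi>)"
  proof (rule eventually_finite_subsets_at_top_weakI)
    fix F assume F: "finite F" "F \<subseteq> A"
    have "infsum ?f A - sum ?f F = infsum ?f (A - F)"
      using infsum_Diff[OF ell2_summable[OF assms], of F] F by simp
    also have "\<dots> = (\<Sum>\<^sub>\<infinity>x\<in>A. (cmod (truncation (- F) \<xi> x))\<^sup>2)"
      by (rule infsum_cong_neutral) (auto simp: truncation_def)
    finally show "sqrt (infsum ?f A - sum ?f F) = ell2_norm A (truncation (- F) \<xi>)"
      by (simp add: ell2_norm_def)
  qed
  ultimately show ?thesis
    by (simp add: tendsto_cong)
qed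

lemma bounded_op_zero_vector: "T \<in> bounded_ops A \<Longrightarrow> T (\<lambda>x. 0) = (\<lambda>x. 0)"
  using bounded_op_scale[OF _ ell2_zero, of T A 0] by simp

lemma ell2_inner_op_truncation:
  assumes T: "T \<in> bounded_ops A" and \<eta>: "\<eta> \<in> ell2 A" and "finite F" "F \<subseteq> A"
  shows "ell2_inner A (T (truncation F \<xi>)) \<eta> = (\<Sum>x\<in>F. \<xi> x * ell2_inner A (T (delta x)) \<eta>)"
  using assms(3,4)
proof (induction F rule: finite_induct)
  case empty
  then show ?case
    by (simp add: truncation_def bounded_op_zero_vector[OF T] ell2_inner_def)
next
  case (insert x F)
  have F: "truncation F \<xi> \<in> ell2 A" and x: "delta x \<in> ell2 A"
    using insert by (auto intro: ell2_finite_support ell2_delta)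
  have split: "truncation (insert x F) \<xi> = (\<lambda>y. truncation F \<xi> y + \<xi> x * delta x y)"
    using insert by (auto simp: truncation_def delta_def)
  have "T (truncation (insert x F) \<xi>) = (\<lambda>y. T (truncation F \<xi>) y + \<xi> x * T (delta x) y)"
    unfolding split using F x by (simp add: bounded_op_add[OF T] bounded_op_scale[OF T] ell2_scale)
  then show ?case
    using insert F x
    by (simp add: ell2_inner_add_left ell2_inner_scale_left ell2_scale bounded_op_in[OF T] \<eta>)
qed

text \<open>A bounded operator is recovered from its values on the point masses: the partial sums over
  finite sets are the values of \<open>T\<close> at the truncations of \<open>\<xi>\<close>, and these converge to \<open>\<xi>\<close> in
  norm.  Both the construction of adjoints and the comparison of operators on point masses rest on
  this expansion.\<close>

lemma bounded_op_expansion: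
  assumes T: "T \<in> bounded_ops A" and \<xi>: "\<xi> \<in> ell2 A" and \<eta>: "\<eta> \<in> ell2 A"
  shows "((\<lambda>x. \<xi> x * ell2_inner A (T (delta x)) \<eta>) has_sum ell2_inner A (T \<xi>) \<eta>) A"
proof -
  obtain C where C: "\<And>\<xi>. \<xi> \<in> ell2 A \<Longrightarrow> ell2_norm A (T \<xi>) \<le> C * ell2_norm A \<xi>"
    using bounded_op_bound[OF T] by metis
  let ?s = "\<lambda>F. \<Sum>x\<in>F. \<xi> x * ell2_inner A (T (delta x)) \<eta>"
  have "((\<lambda>F. ?s F - ell2_inner A (T \<xi>) \<eta>) \<longlongrightarrow> 0) (finite_subsets_at_top A)"
  proof (rule tendsto_0_le[OF ell2_norm_truncation_complement_tendsto[OF \<xi>]],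
      rule eventually_finite_subsets_at_top_weakI)
    fix F assume F: "finite F" "F \<subseteq> A"
    have truncs: "truncation F \<xi> \<in> ell2 A" "truncation (- F) \<xi> \<in> ell2 A"
      using \<xi> by (auto intro: ell2_truncation)
    have "T \<xi> = T (\<lambda>x. truncation F \<xi> x + truncation (- F) \<xi> x)"
      by (rule arg_cong[of _ _ T]) (auto simp: truncation_def)
    also have "\<dots> = (\<lambda>x. T (truncation F \<xi>) x + T (truncation (- F) \<xi>) x)"
      by (rule bounded_op_add[OF T truncs])
    finally have "ell2_inner A (T \<xi>) \<eta> = ?s F + ell2_inner A (T (truncation (- F) \<xi>)) \<eta>"
      using ell2_inner_op_truncation[OF T \<eta> F] by (simp add: ell2_inner_add_left bounded_op_in[OF T] truncs \<eta>)
    then have "norm (?s F - ell2_inner A (T \<xi>) \<eta>) = cmod (ell2_inner A (T (truncation (- F) \<xi>)) \<eta>)"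
      by simp
    also have "\<dots> \<le> ell2_norm A (T (truncation (- F) \<xi>)) * ell2_norm A \<eta>"
      by (intro ell2_Cauchy_Schwarz bounded_op_in[OF T] truncs \<eta>)
    also have "\<dots> \<le> C * ell2_norm A (truncation (- F) \<xi>) * ell2_norm A \<eta>"
      by (intro mult_right_mono C truncs ell2_norm_nonneg)
    finally show "norm (?s F - ell2_inner A (T \<xi>) \<eta>) 
        \<le> norm (ell2_norm A (truncation (- F) \<xi>)) * (C * ell2_norm A \<eta>)"
      by (simp add: ell2_norm_nonneg ac_simps)
  qed
  then show ?thesis
    unfolding has_sum_def by (rule LIM_zero_cancel)
qed

lemma op_eq_deltaI:
  assumes S: "S \<in> bounded_ops A" and T: "T \<in> bounded_ops A"
    and eq: "\<And>x. x \<in> A \<Longrightarrow> S (delta x) = T (delta x)"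
  shows "S = T"
proof (rule op_eq_innerI[OF S T])
  fix \<xi> \<eta> assume \<xi>: "\<xi> \<in> ell2 A" and \<eta>: "\<eta> \<in> ell2 A"
  have "((\<lambda>x. \<xi> x * ell2_inner A (S (delta x)) \<eta>) has_sum ell2_inner A (T \<xi>) \<eta>) A"
    using bounded_op_expansion[OF T \<xi> \<eta>] has_sum_cong[of A "\<lambda>x. \<xi> x * ell2_inner A (S (delta x)) \<eta>"]
    by (simp add: eq)
  then show "ell2_inner A (S \<xi>) \<eta> = ell2_inner A (T \<xi>) \<eta>"
    using bounded_op_expansion[OF S \<xi> \<eta>] has_sum_unique by blast
qed

section \<open>Adjoints\<close>

text \<open>The adjoint of \<open>T\<close> has to send \<open>\<eta>\<close> to the function \<open>c\<close> with \<open>c x = \<langle>\<eta>, T (delta x)\<rangle>\<close>.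
  Testing \<open>T\<close> against the truncation \<open>v\<close> of \<open>c\<close> to a finite set gives
  \<open>\<parallel>v\<parallel>\<^sup>2 = \<langle>T v, \<eta>\<rangle> \<le> C \<parallel>v\<parallel> \<parallel>\<eta>\<parallel>\<close>, hence \<open>\<parallel>v\<parallel> \<le> C \<parallel>\<eta>\<parallel>\<close> uniformly in the finite set.  So \<open>c\<close> is
  square-summable.\<close>

lemma adjoint_coefficients_bounded:
  assumes T: "T \<in> bounded_ops A" and C: "C \<ge> 0"
    "\<And>\<xi>. \<xi> \<in> ell2 A \<Longrightarrow> ell2_norm A (T \<xi>) \<le> C * ell2_norm A \<xi>"
    and \<eta>: "\<eta> \<in> ell2 A" and F: "finite F" "F \<subseteq> A"
  shows "(\<Sum>x\<in>F. (cmod (ell2_inner A \<eta> (T (delta x))))\<^sup>2) \<le> (C * ell2_norm A \<eta>)\<^sup>2"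
proof -
  let ?c = "\<lambda>x. ell2_inner A \<eta> (T (delta x))"
  let ?v = "truncation F ?c"
  have v: "?v \<in> ell2 A" using F by (rule ell2_finite_support)
  have norm_v: "(ell2_norm A ?v)\<^sup>2 = (\<Sum>x\<in>F. (cmod (?c x))\<^sup>2)"
  proof -
    have "(ell2_norm A ?v)\<^sup>2 = (\<Sum>\<^sub>\<infinity>x\<in>F. (cmod (?c x))\<^sup>2)"
      unfolding ell2_norm_sq by (rule infsum_cong_neutral) (use F in \<open>auto simp: truncation_def\<close>)
    then show ?thesis using F by simp
  qed
  have "ell2_inner A (T ?v) \<eta> = (\<Sum>x\<in>F. ?c x * cnj (?c x))"
    unfolding ell2_inner_op_truncation[OF T \<eta> F] by (simp flip: ell2_inner_commute)
  also have "\<dots> = complex_of_real ((ell2_norm A ?v)\<^sup>2)"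
    unfolding norm_v of_real_sum complex_norm_square ..
  finally have "ell2_inner A (T ?v) \<eta> = complex_of_real ((ell2_norm A ?v)\<^sup>2)" .
  then have "(ell2_norm A ?v)\<^sup>2 = cmod (ell2_inner A (T ?v) \<eta>)"
    by (simp add: norm_power)
  also have "\<dots> \<le> ell2_norm A (T ?v) * ell2_norm A \<eta>"
    by (intro ell2_Cauchy_Schwarz bounded_op_in[OF T] v \<eta>)
  also have "\<dots> \<le> C * ell2_norm A ?v * ell2_norm A \<eta>"
    by (intro mult_right_mono C v ell2_norm_nonneg)
  finally have "ell2_norm A ?v * ell2_norm A ?v \<le> ell2_norm A ?v * (C * ell2_norm A \<eta>)"
    by (simp add: power2_eq_square algebra_simps)
  then have "ell2_norm A ?v \<le> C * ell2_norm A \<eta>"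
    using ell2_norm_nonneg[of A ?v] mult_nonneg_nonneg[OF C(1) ell2_norm_nonneg[of A \<eta>]]
    by (cases "ell2_norm A ?v = 0") (auto simp: mult_le_cancel_left)
  then show ?thesis
    unfolding norm_v[symmetric] by (intro power_mono ell2_norm_nonneg)
qed

lemma adjoint_exists:
  assumes T: "T \<in> bounded_ops A"
  shows "\<exists>T'\<in>bounded_ops A. \<forall>\<xi>\<in>ell2 A. \<forall>\<eta>\<in>ell2 A. ell2_inner A (T \<xi>) \<eta> = ell2_inner A \<xi> (T' \<eta>)"
proof -
  obtain C where C: "C \<ge> 0" "\<And>\<xi>. \<xi> \<in> ell2 A \<Longrightarrow> ell2_norm A (T \<xi>) \<le> C * ell2_norm A \<xi>"
    using bounded_op_bound[OF T] by metis
  define T' where "T' = (\<lambda>\<eta>\<in>ell2 A. \<lambda>x. if x \<in> A then ell2_inner A \<eta> (T (delta x)) else 0)"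
  have T'_in: "T' \<eta> \<in> ell2 A" and T'_norm: "ell2_norm A (T' \<eta>) \<le> C * ell2_norm A \<eta>" 
    if \<eta>: "\<eta> \<in> ell2 A" for \<eta>
  proof -
    have bound: "(\<Sum>x\<in>F. (cmod (T' \<eta> x))\<^sup>2) \<le> (C * ell2_norm A \<eta>)\<^sup>2" if "finite F" "F \<subseteq> A" for F
    proof -
      have "(\<Sum>x\<in>F. (cmod (T' \<eta> x))\<^sup>2) = (\<Sum>x\<in>F. (cmod (ell2_inner A \<eta> (T (delta x))))\<^sup>2)"
        by (rule sum.cong) (use \<eta> that in \<open>auto simp: T'_def\<close>)
      then show ?thesis
        using adjoint_coefficients_bounded[OF T C \<eta> that] by simp
    qed
    have sm: "(\<lambda>x. (cmod (T' \<eta> x))\<^sup>2) summable_on A"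
      by (rule nonneg_bdd_above_summable_on) (auto intro!: bdd_aboveI2 bound)
    show "T' \<eta> \<in> ell2 A"
      by (rule ell2I[OF _ sm]) (use \<eta> in \<open>simp add: T'_def\<close>)
    have "(ell2_norm A (T' \<eta>))\<^sup>2 \<le> (C * ell2_norm A \<eta>)\<^sup>2"
      unfolding ell2_norm_sq[of _ "T' \<eta>"] by (rule infsum_le_finite_sums[OF sm bound])
    then show "ell2_norm A (T' \<eta>) \<le> C * ell2_norm A \<eta>"
      by (rule power2_le_imp_le) (simp add: C ell2_norm_nonneg)
  qed
  have "T' \<in> bounded_ops A"
  proof (rule bounded_opI)
    show "T' \<in> extensional (ell2 A)" by (simp add: T'_def)
  next
    fix \<xi> \<eta> assume "\<xi> \<in> ell2 A" "\<eta> \<in> ell2 A"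
    then show "T' (\<lambda>x. \<xi> x + \<eta> x) = (\<lambda>x. T' \<xi> x + T' \<eta> x)"
      by (auto simp: T'_def ell2_add ell2_inner_add_left bounded_op_in[OF T] ell2_delta)
  next
    fix c \<xi> assume "\<xi> \<in> ell2 A"
    then show "T' (\<lambda>x. c * \<xi> x) = (\<lambda>x. c * T' \<xi> x)"
      by (auto simp: T'_def ell2_scale ell2_inner_scale_left)
  qed (use T'_in T'_norm in auto)
  moreover have "ell2_inner A (T \<xi>) \<eta> = ell2_inner A \<xi> (T' \<eta>)"
    if \<xi>: "\<xi> \<in> ell2 A" and \<eta>: "\<eta> \<in> ell2 A" for \<xi> \<eta>
  proof -
    have "ell2_inner A \<xi> (T' \<eta>) = (\<Sum>\<^sub>\<infinity>x\<in>A. \<xi> x * ell2_inner A (T (delta x)) \<eta>)"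
      unfolding ell2_inner_def[of _ \<xi>]
      by (rule infsum_cong) (use \<eta> in \<open>simp add: T'_def flip: ell2_inner_commute\<close>)
    then show ?thesis
      using bounded_op_expansion[OF T \<xi> \<eta>] by (simp add: infsumI)
  qed
  ultimately show ?thesis by blast
qed

text \<open>Every formula for an adjoint below is obtained from this lemma, by checking inner products.\<close>

lemma op_adjoint_unique:
  assumes "T' \<in> bounded_ops A" 
    and "\<And>\<xi> \<eta>. \<xi> \<in> ell2 A \<Longrightarrow> \<eta> \<in> ell2 A \<Longrightarrow> ell2_inner A (T \<xi>) \<eta> = ell2_inner A \<xi> (T' \<eta>)"
  shows "op_adjoint A T = T'"
  unfolding op_adjoint_def
proof (rule the_equality)
  fix T'' assume T'': "T'' \<in> bounded_ops A \<and>
     (\<forall>\<xi>\<in>ell2 A. \<forall>\<eta>\<in>ell2 A. ell2_inner A (T \<xi>) \<eta> = ell2_inner A \<xi> (T'' \<eta>))"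
  show "T'' = T'"
  proof (rule op_eq_innerI)
    fix \<xi> \<eta> assume "\<xi> \<in> ell2 A" "\<eta> \<in> ell2 A"
    then have "ell2_inner A \<eta> (T'' \<xi>) = ell2_inner A \<eta> (T' \<xi>)"
      using T'' assms(2) by metis
    then show "ell2_inner A (T'' \<xi>) \<eta> = ell2_inner A (T' \<xi>) \<eta>"
      by (metis ell2_inner_commute)
  qed (use assms T'' in auto)
qed (use assms in auto)

lemma 
  assumes "T \<in> bounded_ops A"
  shows op_adjoint_bounded: "op_adjoint A T \<in> bounded_ops A"
    and op_adjoint_inner: "\<xi> \<in> ell2 A \<Longrightarrow> \<eta> \<in> ell2 A \<Longrightarrow> 
      ell2_inner A (T \<xi>) \<eta> = ell2_inner A \<xi> (op_adjoint A T \<eta>)"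
proof -
  obtain T' where T': "T' \<in> bounded_ops A" 
    "\<And>\<xi> \<eta>. \<xi> \<in> ell2 A \<Longrightarrow> \<eta> \<in> ell2 A \<Longrightarrow> ell2_inner A (T \<xi>) \<eta> = ell2_inner A \<xi> (T' \<eta>)"
    using adjoint_exists[OF assms] by blast
  have "op_adjoint A T = T'" using T' by (rule op_adjoint_unique)
  with T' show "op_adjoint A T \<in> bounded_ops A" 
    "\<xi> \<in> ell2 A \<Longrightarrow> \<eta> \<in> ell2 A \<Longrightarrow> ell2_inner A (T \<xi>) \<eta> = ell2_inner A \<xi> (op_adjoint A T \<eta>)"
    by auto
qed

section \<open>The algebra of bounded operators\<close>

lemma ell2_norm_scale: "ell2_norm A (\<lambda>x. c * \<xi> x) = cmod c * ell2_norm A \<xi>"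
  unfolding ell2_norm_def
  by (simp add: norm_mult power_mult_distrib infsum_cmult_right' real_sqrt_mult)

lemma ell2_norm_triangle:
  assumes \<xi>: "\<xi> \<in> ell2 A" and \<eta>: "\<eta> \<in> ell2 A"
  shows "ell2_norm A (\<lambda>x. \<xi> x + \<eta> x) \<le> ell2_norm A \<xi> + ell2_norm A \<eta>"
proof -
  let ?z = "\<lambda>x. \<xi> x + \<eta> x"
  have z: "?z \<in> ell2 A" using assms by (rule ell2_add)
  have "(ell2_norm A ?z)\<^sup>2 = cmod (ell2_inner A \<xi> ?z + ell2_inner A \<eta> ?z)"
    using ell2_inner_self[OF z] ell2_inner_add_left[OF \<xi> \<eta> z] by (simp add: norm_power)
  also have "\<dots> \<le> cmod (ell2_inner A \<xi> ?z) + cmod (ell2_inner A \<eta> ?z)"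
    by (rule norm_triangle_ineq)
  also have "\<dots> \<le> ell2_norm A \<xi> * ell2_norm A ?z + ell2_norm A \<eta> * ell2_norm A ?z"
    by (intro add_mono ell2_Cauchy_Schwarz \<xi> \<eta> z)
  finally have "ell2_norm A ?z * ell2_norm A ?z \<le> ell2_norm A ?z * (ell2_norm A \<xi> + ell2_norm A \<eta>)"
    by (simp add: power2_eq_square algebra_simps)
  then show ?thesis
    using ell2_norm_nonneg[of A ?z] ell2_norm_nonneg[of A \<xi>] ell2_norm_nonneg[of A \<eta>]
    by (cases "ell2_norm A ?z = 0") (auto simp: mult_le_cancel_left)
qed

lemma op_mult_apply: "\<xi> \<in> ell2 A \<Longrightarrow> op_mult A S T \<xi> = S (T \<xi>)"
  by (simp add: op_mult_def compose_def)

lemma op_add_apply: "\<xi> \<in> ell2 A \<Longrightarrow> op_add A S T \<xi> = (\<lambda>x. S \<xi> x + T \<xi> x)"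
  by (simp add: op_add_def)

lemma op_scale_apply: "\<xi> \<in> ell2 A \<Longrightarrow> op_scale A c T \<xi> = (\<lambda>x. c * T \<xi> x)"
  by (simp add: op_scale_def)

lemma op_one_apply: "\<xi> \<in> ell2 A \<Longrightarrow> op_one A \<xi> = \<xi>"
  by (simp add: op_one_def)

lemma op_zero_apply: "\<xi> \<in> ell2 A \<Longrightarrow> op_zero A \<xi> = (\<lambda>x. 0)"
  by (simp add: op_zero_def)

lemmas op_apply = op_mult_apply op_add_apply op_scale_apply op_one_apply op_zero_apply

lemma op_mult_bounded:
  assumes S: "S \<in> bounded_ops A" and T: "T \<in> bounded_ops A"
  shows "op_mult A S T \<in> bounded_ops A"
proof -
  obtain C where C: "C \<ge> 0" "\<And>\<xi>. \<xi> \<in> ell2 A \<Longrightarrow> ell2_norm A (S \<xi>) \<le> C * ell2_norm A \<xi>"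
    using bounded_op_bound[OF S] by metis
  obtain D where D: "D \<ge> 0" "\<And>\<xi>. \<xi> \<in> ell2 A \<Longrightarrow> ell2_norm A (T \<xi>) \<le> D * ell2_norm A \<xi>"
    using bounded_op_bound[OF T] by metis
  show ?thesis
  proof (rule bounded_opI)
    show "op_mult A S T \<in> extensional (ell2 A)" by (simp add: op_mult_def)
  next
    fix \<xi> assume \<xi>: "\<xi> \<in> ell2 A"
    have "ell2_norm A (S (T \<xi>)) \<le> C * ell2_norm A (T \<xi>)"
      by (intro C bounded_op_in[OF T] \<xi>)
    also have "\<dots> \<le> C * (D * ell2_norm A \<xi>)"
      by (intro mult_left_mono C D \<xi>)
    finally show "ell2_norm A (op_mult A S T \<xi>) \<le> (C * D) * ell2_norm A \<xi>"
      using \<xi> by (simp add: op_apply mult.assoc)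
  qed (simp_all add: op_apply ell2_add ell2_scale bounded_op_add[OF T] bounded_op_add[OF S]
      bounded_op_scale[OF T] bounded_op_scale[OF S] bounded_op_in[OF T] bounded_op_in[OF S])
qed

lemma op_add_bounded:
  assumes S: "S \<in> bounded_ops A" and T: "T \<in> bounded_ops A"
  shows "op_add A S T \<in> bounded_ops A"
proof -
  obtain C where C: "\<And>\<xi>. \<xi> \<in> ell2 A \<Longrightarrow> ell2_norm A (S \<xi>) \<le> C * ell2_norm A \<xi>"
    using bounded_op_bound[OF S] by metis
  obtain D where D: "\<And>\<xi>. \<xi> \<in> ell2 A \<Longrightarrow> ell2_norm A (T \<xi>) \<le> D * ell2_norm A \<xi>"
    using bounded_op_bound[OF T] by metis
  show ?thesis
  proof (rule bounded_opI)
    show "op_add A S T \<in> extensional (ell2 A)" by (simp add: op_add_def)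
  next
    fix \<xi> assume \<xi>: "\<xi> \<in> ell2 A"
    have "ell2_norm A (op_add A S T \<xi>) \<le> ell2_norm A (S \<xi>) + ell2_norm A (T \<xi>)"
      using \<xi> by (simp add: op_apply ell2_norm_triangle bounded_op_in[OF T] bounded_op_in[OF S])
    also have "\<dots> \<le> (C + D) * ell2_norm A \<xi>"
      using C[OF \<xi>] D[OF \<xi>] by (simp add: algebra_simps)
    finally show "ell2_norm A (op_add A S T \<xi>) \<le> (C + D) * ell2_norm A \<xi>" .
  qed (simp_all add: op_apply ell2_add ell2_scale bounded_op_add[OF T] bounded_op_add[OF S]
      bounded_op_scale[OF T] bounded_op_scale[OF S] bounded_op_in[OF T] bounded_op_in[OF S] algebra_simps)
qed

lemma op_scale_bounded:
  assumes T: "T \<in> bounded_ops A"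
  shows "op_scale A c T \<in> bounded_ops A"
proof -
  obtain D where D: "\<And>\<xi>. \<xi> \<in> ell2 A \<Longrightarrow> ell2_norm A (T \<xi>) \<le> D * ell2_norm A \<xi>"
    using bounded_op_bound[OF T] by metis
  show ?thesis
  proof (rule bounded_opI)
    show "op_scale A c T \<in> extensional (ell2 A)" by (simp add: op_scale_def)
  next
    fix \<xi> assume \<xi>: "\<xi> \<in> ell2 A"
    have "cmod c * ell2_norm A (T \<xi>) \<le> cmod c * (D * ell2_norm A \<xi>)"
      by (intro mult_left_mono D \<xi>) simp
    then show "ell2_norm A (op_scale A c T \<xi>) \<le> (cmod c * D) * ell2_norm A \<xi>"
      using \<xi> by (simp add: op_apply ell2_norm_scale mult.assoc)
  qed (simp_all add: op_apply ell2_add ell2_scale bounded_op_add[OF T]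
      bounded_op_scale[OF T] bounded_op_in[OF T] algebra_simps)
qed

lemma op_one_bounded: "op_one A \<in> bounded_ops A"
  by (rule bounded_opI[where C = 1]) (auto simp: op_one_def ell2_add ell2_scale)

lemma op_zero_bounded: "op_zero A \<in> bounded_ops A"
  by (rule bounded_opI[where C = 0]) (auto simp: op_zero_def ell2_add ell2_scale ell2_zero ell2_norm_def)

lemmas op_bounded = op_mult_bounded op_add_bounded op_scale_bounded op_one_bounded op_zero_bounded
  op_adjoint_bounded

lemma op_adjoint_inner':
  assumes "T \<in> bounded_ops A" "\<xi> \<in> ell2 A" "\<eta> \<in> ell2 A"
  shows "ell2_inner A (op_adjoint A T \<xi>) \<eta> = ell2_inner A \<xi> (T \<eta>)"
  using op_adjoint_inner[OF assms(1,3,2)] by (metis ell2_inner_commute)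

lemma op_adjoint_adjoint: "T \<in> bounded_ops A \<Longrightarrow> op_adjoint A (op_adjoint A T) = T"
  by (rule op_adjoint_unique) (auto simp: op_adjoint_inner')

lemma op_adjoint_mult:
  assumes "S \<in> bounded_ops A" "T \<in> bounded_ops A"
  shows "op_adjoint A (op_mult A S T) = op_mult A (op_adjoint A T) (op_adjoint A S)"
  by (rule op_adjoint_unique)
    (use assms in \<open>auto simp: op_apply op_bounded op_adjoint_inner bounded_op_in\<close>)

lemma op_adjoint_scale:
  assumes "T \<in> bounded_ops A"
  shows "op_adjoint A (op_scale A c T) = op_scale A (cnj c) (op_adjoint A T)"
  by (rule op_adjoint_unique)
    (use assms in \<open>auto simp: op_apply op_bounded op_adjoint_inner bounded_op_in
      ell2_inner_scale_left ell2_inner_scale_right\<close>)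

section \<open>Commutants\<close>

lemma commutant_iff:
  "T \<in> commutant A M \<longleftrightarrow> T \<in> bounded_ops A \<and> (\<forall>S\<in>M. \<forall>\<xi>\<in>ell2 A. S (T \<xi>) = T (S \<xi>))"
proof -
  have "op_mult A S T = op_mult A T S \<longleftrightarrow> (\<forall>\<xi>\<in>ell2 A. S (T \<xi>) = T (S \<xi>))" for S
  proof
    assume "op_mult A S T = op_mult A T S"
    then have "op_mult A S T \<xi> = op_mult A T S \<xi>" for \<xi> by simp
    then show "\<forall>\<xi>\<in>ell2 A. S (T \<xi>) = T (S \<xi>)" by (metis op_mult_apply)
  next
    assume "\<forall>\<xi>\<in>ell2 A. S (T \<xi>) = T (S \<xi>)"
    then show "op_mult A S T = op_mult A T S"
      unfolding op_mult_def compose_def by (intro restrict_ext) simp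
  qed
  then show ?thesis by (auto simp: commutant_def)
qed

lemma commutantI:
  assumes "T \<in> bounded_ops A" "\<And>S \<xi>. S \<in> M \<Longrightarrow> \<xi> \<in> ell2 A \<Longrightarrow> S (T \<xi>) = T (S \<xi>)"
  shows "T \<in> commutant A M"
  using assms by (simp add: commutant_iff)

lemma commutant_bounded: "T \<in> commutant A M \<Longrightarrow> T \<in> bounded_ops A"
  by (simp add: commutant_iff)

lemma commutantD: "T \<in> commutant A M \<Longrightarrow> S \<in> M \<Longrightarrow> \<xi> \<in> ell2 A \<Longrightarrow> S (T \<xi>) = T (S \<xi>)"
  by (simp add: commutant_iff)

lemma commutant_antimono: "X \<subseteq> Y \<Longrightarrow> commutant A Y \<subseteq> commutant A X"
  unfolding commutant_def by blast

lemma double_commutant_extensive: "X \<subseteq> bounded_ops A \<Longrightarrow> X \<subseteq> commutant A (commutant A X)"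
  by (auto simp: commutant_iff)

lemma triple_commutant:
  "X \<subseteq> bounded_ops A \<Longrightarrow> commutant A (commutant A (commutant A X)) = commutant A X"
  by (intro equalityI commutant_antimono double_commutant_extensive)
    (auto dest: commutant_bounded)

lemma commutant_mult:
  assumes "M \<subseteq> bounded_ops A" "S \<in> commutant A M" "T \<in> commutant A M"
  shows "op_mult A S T \<in> commutant A M"
  using assms by (auto simp: commutant_iff op_apply op_bounded bounded_op_in subset_iff)

lemma commutant_add:
  assumes "M \<subseteq> bounded_ops A" "S \<in> commutant A M" "T \<in> commutant A M"
  shows "op_add A S T \<in> commutant A M"
  using assms by (auto simp: commutant_iff op_apply op_bounded bounded_op_in bounded_op_add subset_iff)

lemma commutant_scale:
  assumes "M \<subseteq> bounded_ops A" "T \<in> commutant A M"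
  shows "op_scale A c T \<in> commutant A M"
  using assms by (auto simp: commutant_iff op_apply op_bounded bounded_op_in bounded_op_scale subset_iff)

text \<open>Usually \<open>X\<close> is required to be closed under adjoints.  The generators of a twisted group
  algebra are closed under adjoints only up to scalars, which is why the hypothesis allows the
  adjoints to lie in the double commutant: there they still commute with \<open>T\<close>.\<close>

lemma commutant_adjoint:
  assumes X: "X \<subseteq> bounded_ops A" and adj: "\<And>S. S \<in> X \<Longrightarrow> op_adjoint A S \<in> commutant A (commutant A X)"
    and T: "T \<in> commutant A X"
  shows "op_adjoint A T \<in> commutant A X"
proof (rule commutantI)
  have T_bd: "T \<in> bounded_ops A" using T by (rule commutant_bounded)
  then show adj_T: "op_adjoint A T \<in> bounded_ops A" by (rule op_adjoint_bounded)
  fix S \<xi> assume S: "S \<in> X" and \<xi>: "\<xi> \<in> ell2 A"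
  have S_bd: "S \<in> bounded_ops A" using S X by blast
  let ?S' = "op_adjoint A S" and ?T' = "op_adjoint A T"
  have S'_bd: "?S' \<in> bounded_ops A" using S_bd by (rule op_adjoint_bounded)
  have "S (?T' \<xi>) = op_mult A S ?T' \<xi>" using \<xi> by (simp add: op_apply)
  also have "op_mult A S ?T' = op_mult A ?T' S"
  proof (rule op_eq_innerI)
    fix \<zeta> \<eta> assume v: "\<zeta> \<in> ell2 A" "\<eta> \<in> ell2 A"
    have "ell2_inner A (S (?T' \<zeta>)) \<eta> = ell2_inner A \<zeta> (T (?S' \<eta>))"
      using v by (simp add: op_adjoint_inner[OF S_bd] op_adjoint_inner'[OF T_bd] 
          bounded_op_in[OF S'_bd] bounded_op_in[OF adj_T])
    also have "T (?S' \<eta>) = ?S' (T \<eta>)"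
      using commutantD[OF adj[OF S] T v(2)] by simp
    also have "ell2_inner A \<zeta> (?S' (T \<eta>)) = ell2_inner A (?T' (S \<zeta>)) \<eta>"
      using v by (simp add: op_adjoint_inner[OF S_bd, symmetric] op_adjoint_inner'[OF T_bd] 
          bounded_op_in[OF S_bd] bounded_op_in[OF T_bd])
    finally show "ell2_inner A (op_mult A S ?T' \<zeta>) \<eta> = ell2_inner A (op_mult A ?T' S \<zeta>) \<eta>"
      using v by (simp add: op_apply)
  qed (intro op_bounded S_bd T_bd)+
  finally show "S (?T' \<xi>) = ?T' (S \<xi>)" using \<xi> by (simp add: op_apply)
qed

text \<open>The double commutant is a von Neumann algebra containing \<open>X\<close>, and it lies in every other
  von Neumann algebra containing \<open>X\<close> because taking commutants twice is monotone.\<close>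

lemma vN_generated_eq_double_commutant:
  assumes X: "X \<subseteq> bounded_ops A" and adj: "\<And>S. S \<in> X \<Longrightarrow> op_adjoint A S \<in> commutant A (commutant A X)"
  shows "vN_generated A X = commutant A (commutant A X)"
proof (rule equalityI)
  have X': "commutant A X \<subseteq> bounded_ops A" by (auto dest: commutant_bounded)
  have "op_adjoint A T \<in> commutant A (commutant A X)" if "T \<in> commutant A (commutant A X)" for T
  proof (rule commutant_adjoint[OF X' _ that])
    fix S assume S: "S \<in> commutant A X"
    have "op_adjoint A S \<in> commutant A X" by (rule commutant_adjoint[OF X _ S], rule adj)
    then show "op_adjoint A S \<in> commutant A (commutant A (commutant A X))"
      using double_commutant_extensive[OF X'] by blast
  qed
  then have "von_neumann_algebra A (commutant A (commutant A X))"
    using triple_commutant[OF X'] by (auto simp: von_neumann_algebra_def dest: commutant_bounded)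
  then show "vN_generated A X \<subseteq> commutant A (commutant A X)"
    using double_commutant_extensive[OF X] by (auto simp: vN_generated_def)
  show "commutant A (commutant A X) \<subseteq> vN_generated A X"
    unfolding vN_generated_def
  proof (rule Inter_greatest)
    fix M assume "M \<in> {M. von_neumann_algebra A M \<and> X \<subseteq> M}"
    then have "commutant A (commutant A M) = M" "X \<subseteq> M" by (auto simp: von_neumann_algebra_def)
    then show "commutant A (commutant A X) \<subseteq> M"
      using commutant_antimono[OF commutant_antimono[OF \<open>X \<subseteq> M\<close>], of A A] by simp
  qed
qed

section \<open>Unitary conjugation\<close>

abbreviation unitary_op :: "'a set \<Rightarrow> 'a operator \<Rightarrow> bool" where
  "unitary_op A \<equiv> vN_unitary A (bounded_ops A)"

lemma unitary_bounded: "unitary_op A U \<Longrightarrow> U \<in> bounded_ops A"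
  by (simp add: vN_unitary_def)

lemma 
  assumes "unitary_op A U" "\<xi> \<in> ell2 A"
  shows unitary_adjoint_left: "op_adjoint A U (U \<xi>) = \<xi>"
    and unitary_adjoint_right: "U (op_adjoint A U \<xi>) = \<xi>"
proof -
  have "op_mult A (op_adjoint A U) U \<xi> = \<xi>" "op_mult A U (op_adjoint A U) \<xi> = \<xi>"
    using assms by (simp_all add: vN_unitary_def op_one_apply)
  then show "op_adjoint A U (U \<xi>) = \<xi>" "U (op_adjoint A U \<xi>) = \<xi>"
    using assms(2) by (simp_all add: op_mult_apply)
qed

lemma unitaryI:
  assumes "U \<in> bounded_ops A" "W \<in> bounded_ops A"
    and iso: "\<And>\<xi> \<eta>. \<xi> \<in> ell2 A \<Longrightarrow> \<eta> \<in> ell2 A \<Longrightarrow> ell2_inner A (U \<xi>) (U \<eta>) = ell2_inner A \<xi> \<eta>"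
    and inv: "\<And>\<xi>. \<xi> \<in> ell2 A \<Longrightarrow> U (W \<xi>) = \<xi>" "\<And>\<xi>. \<xi> \<in> ell2 A \<Longrightarrow> W (U \<xi>) = \<xi>"
  shows "unitary_op A U" and "op_adjoint A U = W"
proof -
  show adj: "op_adjoint A U = W"
  proof (rule op_adjoint_unique)
    fix \<xi> \<eta> assume "\<xi> \<in> ell2 A" "\<eta> \<in> ell2 A"
    then show "ell2_inner A (U \<xi>) \<eta> = ell2_inner A \<xi> (W \<eta>)"
      using iso[of \<xi> "W \<eta>"] inv(1)[of \<eta>] assms(2) by (simp add: bounded_op_in)
  qed (fact assms(2))
  have "op_mult A W U = op_one A" "op_mult A U W = op_one A"
    using assms by (auto intro!: op_eqI op_bounded simp: op_apply)
  then show "unitary_op A U" using assms by (simp add: vN_unitary_def adj)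
qed

lemma op_conj_apply: "\<xi> \<in> ell2 A \<Longrightarrow> U \<in> bounded_ops A \<Longrightarrow> op_conj A U T \<xi> = U (T (op_adjoint A U \<xi>))"
  by (simp add: op_conj_def op_apply bounded_op_in op_bounded)

lemma op_conj_bounded: "U \<in> bounded_ops A \<Longrightarrow> T \<in> bounded_ops A \<Longrightarrow> op_conj A U T \<in> bounded_ops A"
  by (simp add: op_conj_def op_bounded)

text \<open>The criterion \<open>U T = S U\<close> avoids computing with the adjoint of \<open>U\<close>.\<close>

lemma op_conj_eqI:
  assumes U: "unitary_op A U" and "S \<in> bounded_ops A" "T \<in> bounded_ops A"
    and "\<And>\<xi>. \<xi> \<in> ell2 A \<Longrightarrow> U (T \<xi>) = S (U \<xi>)"
  shows "op_conj A U T = S"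
  by (rule op_eqI)
    (use assms in \<open>auto intro!: op_conj_bounded dest: unitary_bounded 
      simp: op_conj_apply unitary_adjoint_right unitary_bounded op_bounded bounded_op_in\<close>)

lemma op_conj_adjoint_cancel:
  assumes "unitary_op A U" "T \<in> bounded_ops A"
  shows "op_conj A (op_adjoint A U) (op_conj A U T) = T"
    and "op_conj A U (op_conj A (op_adjoint A U) T) = T"
proof -
  note bd = unitary_bounded[OF assms(1)]
  show "op_conj A (op_adjoint A U) (op_conj A U T) = T" 
    "op_conj A U (op_conj A (op_adjoint A U) T) = T"
    using assms bd by (auto intro!: op_eqI op_conj_bounded op_bounded 
        simp: op_conj_apply op_bounded op_adjoint_adjoint unitary_adjoint_left unitary_adjoint_right bounded_op_in)
qed

lemma op_conj_scale_left:
  assumes "cmod c = 1" "U \<in> bounded_ops A" "T \<in> bounded_ops A"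
  shows "op_conj A (op_scale A c U) T = op_conj A U T"
proof -
  have "c * cnj c = 1" using assms(1) by (simp flip: complex_norm_square)
  then show ?thesis
    using assms(2,3)
    by (auto intro!: op_eqI op_conj_bounded op_bounded simp: op_conj_apply op_bounded op_adjoint_scale
        op_apply bounded_op_in bounded_op_scale ell2_scale simp flip: mult.assoc)
qed

text \<open>To see that the conjugate of \<open>T\<close> by \<open>U\<close> commutes with \<open>Y\<close> in the commutant, move the
  conjugation to the other side: the conjugate \<open>Z\<close> of \<open>Y\<close> by the adjoint of \<open>U\<close> lies in the
  commutant again, since conjugation by \<open>U\<close> sends \<open>X\<close> into the double commutant, and so \<open>Z\<close>
  commutes with \<open>T\<close>.\<close>

lemma op_conj_double_commutant:
  assumes U: "unitary_op A U" and X: "X \<subseteq> bounded_ops A" 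
    and conj: "\<And>S. S \<in> X \<Longrightarrow> op_conj A U S \<in> commutant A (commutant A X)"
    and T: "T \<in> commutant A (commutant A X)"
  shows "op_conj A U T \<in> commutant A (commutant A X)"
proof (rule commutantI)
  note U_bd = unitary_bounded[OF U]
  note U'_bd = op_adjoint_bounded[OF U_bd]
  note T_bd = commutant_bounded[OF T]
  show "op_conj A U T \<in> bounded_ops A" by (intro op_conj_bounded U_bd T_bd)
  fix Y \<xi> assume Y: "Y \<in> commutant A X" and \<xi>: "\<xi> \<in> ell2 A"
  note Y_bd = commutant_bounded[OF Y]
  define Z where "Z = op_conj A (op_adjoint A U) Y"
  have Z_bd: "Z \<in> bounded_ops A" unfolding Z_def by (intro op_conj_bounded U'_bd Y_bd)
  have Z: "Z \<zeta> = op_adjoint A U (Y (U \<zeta>))" if "\<zeta> \<in> ell2 A" for \<zeta>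
    using that by (simp add: Z_def op_conj_apply U'_bd op_adjoint_adjoint[OF U_bd])
  note ins = bounded_op_in[OF U_bd] bounded_op_in[OF U'_bd] bounded_op_in[OF T_bd] bounded_op_in[OF Y_bd]
    bounded_op_in[OF Z_bd]
  note cancel = unitary_adjoint_left[OF U] unitary_adjoint_right[OF U]
  have "Z \<in> commutant A X"
  proof (rule commutantI[OF Z_bd])
    fix S \<zeta> assume S: "S \<in> X" and \<zeta>: "\<zeta> \<in> ell2 A"
    have S_in: "S \<zeta>' \<in> ell2 A" if "\<zeta>' \<in> ell2 A" for \<zeta>'
      using that S X by (auto intro: bounded_op_in)
    have "Z (S \<zeta>) = op_adjoint A U (Y (op_conj A U S (U \<zeta>)))"
      using \<zeta> by (simp add: Z S_in op_conj_apply U_bd ins cancel)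
    also have "Y (op_conj A U S (U \<zeta>)) = op_conj A U S (Y (U \<zeta>))"
      using commutantD[OF conj[OF S] Y, of "U \<zeta>"] \<zeta> by (simp add: ins)
    also have "op_adjoint A U \<dots> = S (Z \<zeta>)"
      using \<zeta> by (simp add: Z S_in op_conj_apply U_bd ins cancel)
    finally show "S (Z \<zeta>) = Z (S \<zeta>)" by simp
  qed
  have "Y (op_conj A U T \<xi>) = U (Z (T (op_adjoint A U \<xi>)))"
    using \<xi> by (simp add: Z op_conj_apply U_bd ins cancel)
  also have "Z (T (op_adjoint A U \<xi>)) = T (Z (op_adjoint A U \<xi>))"
    using commutantD[OF T \<open>Z \<in> commutant A X\<close>] \<xi> by (simp add: ins)
  also have "U \<dots> = op_conj A U T (Y \<xi>)"
    using \<xi> by (simp add: Z op_conj_apply U_bd ins cancel)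
  finally show "Y (op_conj A U T \<xi>) = op_conj A U T (Y \<xi>)" .
qed

lemma op_conj_automorphism:
  assumes U: "unitary_op A U" and M_bd: "M \<subseteq> bounded_ops A"
    and M_add: "\<And>S T. S \<in> M \<Longrightarrow> T \<in> M \<Longrightarrow> op_add A S T \<in> M"
    and M_scale: "\<And>c T. T \<in> M \<Longrightarrow> op_scale A c T \<in> M"
    and M_mult: "\<And>S T. S \<in> M \<Longrightarrow> T \<in> M \<Longrightarrow> op_mult A S T \<in> M"
    and M_adj: "\<And>T. T \<in> M \<Longrightarrow> op_adjoint A T \<in> M"
    and conj: "\<And>T. T \<in> M \<Longrightarrow> op_conj A U T \<in> M"
    and conj': "\<And>T. T \<in> M \<Longrightarrow> op_conj A (op_adjoint A U) T \<in> M"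
  shows "vN_automorphism A M (\<lambda>T\<in>M. op_conj A U T)"
proof -
  note U_bd = unitary_bounded[OF U]
  note U'_bd = op_adjoint_bounded[OF U_bd]
  note cancel = unitary_adjoint_left[OF U] unitary_adjoint_right[OF U]
  note U_in = bounded_op_in[OF U_bd] bounded_op_in[OF U'_bd]
  have bd: "T \<in> bounded_ops A" if "T \<in> M" for T using that M_bd by blast
  have "bij_betw (\<lambda>T\<in>M. op_conj A U T) M M"
    by (rule bij_betw_byWitness[where f' = "op_conj A (op_adjoint A U)"])
      (auto simp: conj conj' op_conj_adjoint_cancel[OF U] bd)
  moreover have "op_conj A U (op_add A S T) = op_add A (op_conj A U S) (op_conj A U T)"
    if "S \<in> M" "T \<in> M" for S T
    by (rule op_eqI[of _ A]) (auto intro!: op_bounded op_conj_bounded U_bd bd M_add M_scale M_mult conj that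
        simp: op_conj_apply U_bd op_apply U_in bounded_op_add[OF U_bd] bounded_op_in[OF bd] that)
  moreover have "op_conj A U (op_scale A c T) = op_scale A c (op_conj A U T)"
    if "T \<in> M" for c T
    by (rule op_eqI[of _ A]) (auto intro!: op_bounded op_conj_bounded U_bd bd M_add M_scale M_mult conj that
        simp: op_conj_apply U_bd op_apply U_in bounded_op_scale[OF U_bd] bounded_op_in[OF bd] that)
  moreover have "op_conj A U (op_mult A S T) = op_mult A (op_conj A U S) (op_conj A U T)"
    if "S \<in> M" "T \<in> M" for S T
    by (rule op_eqI[of _ A]) (auto intro!: op_bounded op_conj_bounded U_bd bd M_add M_scale M_mult conj that
        simp: op_conj_apply U_bd op_apply U_in bounded_op_in[OF bd] that cancel)
  moreover have "op_conj A U (op_adjoint A T) = op_adjoint A (op_conj A U T)" if "T \<in> M" for T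
  proof -
    have "op_adjoint A (op_conj A U T) = 
        op_mult A U (op_mult A (op_adjoint A T) (op_adjoint A U))"
      by (simp add: op_conj_def op_adjoint_mult op_adjoint_adjoint op_bounded U_bd bd[OF that])
    also have "\<dots> = op_conj A U (op_adjoint A T)"
      by (rule op_eqI[of _ A]) (auto intro!: op_bounded op_conj_bounded U_bd bd[OF that]
        simp: op_conj_apply U_bd op_apply U_in)
    finally show ?thesis by simp
  qed
  ultimately show ?thesis
    using M_add M_scale M_mult M_adj by (simp add: vN_automorphism_def)
qed

section \<open>Weighted substitution operators\<close>

text \<open>Left translations, right translations and multiplication by indicator functions are all of
  this form.  Weights of absolute value one give isometries.\<close>

definition weighted_subst :: "'a set \<Rightarrow> ('a \<Rightarrow> complex) \<Rightarrow> ('a \<Rightarrow> 'a) \<Rightarrow> 'a operator" where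
  "weighted_subst A w \<pi> = (\<lambda>\<xi>\<in>ell2 A. \<lambda>x. if x \<in> A then w x * \<xi> (\<pi> x) else 0)"

lemma weighted_subst_bounded:
  assumes \<pi>: "bij_betw \<pi> A A" and w: "\<And>x. x \<in> A \<Longrightarrow> cmod (w x) \<le> 1"
  shows "weighted_subst A w \<pi> \<in> bounded_ops A"
proof (rule bounded_opI[where C = 1])
  show "weighted_subst A w \<pi> \<in> extensional (ell2 A)" by (simp add: weighted_subst_def)
next
  fix \<xi> assume \<xi>: "\<xi> \<in> ell2 A"
  let ?\<zeta> = "weighted_subst A w \<pi> \<xi>"
  have sm: "(\<lambda>x. (cmod (\<xi> (\<pi> x)))\<^sup>2) summable_on A"
    using summable_on_reindex_bij_betw[OF \<pi>, of "\<lambda>x. (cmod (\<xi> x))\<^sup>2"] ell2_summable[OF \<xi>] by simp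
  have le: "(cmod (?\<zeta> x))\<^sup>2 \<le> (cmod (\<xi> (\<pi> x)))\<^sup>2" if "x \<in> A" for x
    using that \<xi> mult_right_mono[OF w[OF that] norm_ge_zero[of "\<xi> (\<pi> x)"]]
    by (auto simp: weighted_subst_def norm_mult intro!: power_mono)
  show in_ell2: "?\<zeta> \<in> ell2 A"
    by (rule ell2_dominated[OF sm le]) (use \<xi> in \<open>auto simp: weighted_subst_def\<close>)
  have "(ell2_norm A ?\<zeta>)\<^sup>2 \<le> (\<Sum>\<^sub>\<infinity>x\<in>A. (cmod (\<xi> (\<pi> x)))\<^sup>2)"
    unfolding ell2_norm_sq by (rule infsum_mono[OF ell2_summable[OF in_ell2] sm le])
  also have "\<dots> = (ell2_norm A \<xi>)\<^sup>2"
    unfolding ell2_norm_sq using infsum_reindex_bij_betw[OF \<pi>, of "\<lambda>x. (cmod (\<xi> x))\<^sup>2"] by simp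
  finally show "ell2_norm A ?\<zeta> \<le> 1 * ell2_norm A \<xi>"
    using power2_le_imp_le ell2_norm_nonneg by fastforce
qed (auto simp: weighted_subst_def ell2_add ell2_scale algebra_simps)

lemma weighted_subst_isometric:
  assumes \<pi>: "bij_betw \<pi> A A" and w: "\<And>x. x \<in> A \<Longrightarrow> cmod (w x) = 1"
    and \<xi>: "\<xi> \<in> ell2 A" and \<eta>: "\<eta> \<in> ell2 A"
  shows "ell2_inner A (weighted_subst A w \<pi> \<xi>) (weighted_subst A w \<pi> \<eta>) = ell2_inner A \<xi> \<eta>"
proof -
  have ww: "w x * cnj (w x) = 1" if "x \<in> A" for x
    using w[OF that] by (simp flip: complex_norm_square)
  have "ell2_inner A (weighted_subst A w \<pi> \<xi>) (weighted_subst A w \<pi> \<eta>) 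
      = (\<Sum>\<^sub>\<infinity>x\<in>A. \<xi> (\<pi> x) * cnj (\<eta> (\<pi> x)))"
    unfolding ell2_inner_def
  proof (rule infsum_cong)
    fix x assume x: "x \<in> A"
    have "w x * \<xi> (\<pi> x) * cnj (w x * \<eta> (\<pi> x)) = (w x * cnj (w x)) * (\<xi> (\<pi> x) * cnj (\<eta> (\<pi> x)))"
      by (simp add: ac_simps)
    then show "weighted_subst A w \<pi> \<xi> x * cnj (weighted_subst A w \<pi> \<eta> x) = \<xi> (\<pi> x) * cnj (\<eta> (\<pi> x))"
      using x \<xi> \<eta> ww[OF x] by (simp add: weighted_subst_def)
  qed
  then show ?thesis
    unfolding ell2_inner_def using infsum_reindex_bij_betw[OF \<pi>, of "\<lambda>x. \<xi> x * cnj (\<eta> x)"] by simp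
qed

section \<open>Twisted translations\<close>

locale twisted_group = group G for G (structure) +
  fixes \<sigma> :: "'a \<Rightarrow> 'a \<Rightarrow> complex"
  assumes cocycle: "\<sigma> \<in> cocycles G"
begin

lemma cocycle_norm: "g \<in> carrier G \<Longrightarrow> h \<in> carrier G \<Longrightarrow> cmod (\<sigma> g h) = 1"
  using cocycle by (simp add: cocycles_def)

lemma cocycle_one_right: "g \<in> carrier G \<Longrightarrow> \<sigma> g \<one> = 1"
  using cocycle by (simp add: cocycles_def)

lemma cocycle_one_left: "g \<in> carrier G \<Longrightarrow> \<sigma> \<one> g = 1"
  using cocycle by (simp add: cocycles_def)

lemma cocycle_identity:
  "g \<in> carrier G \<Longrightarrow> h \<in> carrier G \<Longrightarrow> k \<in> carrier G \<Longrightarrow>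
    \<sigma> g h * \<sigma> (g \<otimes> h) k = \<sigma> h k * \<sigma> g (h \<otimes> k)"
  using cocycle by (simp add: cocycles_def)

lemma cocycle_mult_cnj: "g \<in> carrier G \<Longrightarrow> h \<in> carrier G \<Longrightarrow> cnj (\<sigma> g h) * \<sigma> g h = 1"
  using cocycle_norm[of g h] complex_norm_square[of "\<sigma> g h"] by (simp add: mult.commute)

lemma cocycle_inv_commute:
  assumes "g \<in> carrier G" shows "\<sigma> (inv g) g = \<sigma> g (inv g)"
  using cocycle_identity[of g "inv g" g] assms by (simp add: cocycle_one_left cocycle_one_right)

abbreviation "lam \<equiv> twisted_regular G \<sigma>"

text \<open>The right translation twisted so that \<open>rho s (delta x)\<close> is \<open>\<sigma> x s\<close> times \<open>delta (x \<otimes> s)\<close>, the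
  mirror image of the left translation.  The cocycle identity is exactly the statement that the two
  kinds of translations commute.\<close>

definition rho :: "'a \<Rightarrow> 'a operator" where
  "rho s = weighted_subst (carrier G) (\<lambda>x. \<sigma> (x \<otimes> inv s) s) (\<lambda>x. x \<otimes> inv s)"

lemma lam_weighted_subst:
  "lam g = weighted_subst (carrier G) (\<lambda>h. \<sigma> g (inv g \<otimes> h)) (\<lambda>h. inv g \<otimes> h)"
  by (simp add: twisted_regular_def weighted_subst_def)

lemma lam_apply: 
  "\<xi> \<in> ell2 (carrier G) \<Longrightarrow> x \<in> carrier G \<Longrightarrow> lam g \<xi> x = \<sigma> g (inv g \<otimes> x) * \<xi> (inv g \<otimes> x)"
  by (simp add: twisted_regular_def)

lemma rho_apply: 
  "\<xi> \<in> ell2 (carrier G) \<Longrightarrow> x \<in> carrier G \<Longrightarrow> rho s \<xi> x = \<sigma> (x \<otimes> inv s) s * \<xi> (x \<otimes> inv s)"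
  by (simp add: rho_def weighted_subst_def)

lemma bij_left_translation: "g \<in> carrier G \<Longrightarrow> bij_betw (\<lambda>h. g \<otimes> h) (carrier G) (carrier G)"
  by (rule bij_betw_byWitness[where f' = "\<lambda>h. inv g \<otimes> h"]) (auto simp: m_assoc[symmetric])

lemma bij_right_translation: "g \<in> carrier G \<Longrightarrow> bij_betw (\<lambda>h. h \<otimes> g) (carrier G) (carrier G)"
  by (rule bij_betw_byWitness[where f' = "\<lambda>h. h \<otimes> inv g"]) (auto simp: m_assoc)

lemma lam_bounded: "g \<in> carrier G \<Longrightarrow> lam g \<in> bounded_ops (carrier G)"
  unfolding lam_weighted_subst
  by (rule weighted_subst_bounded) (auto simp: bij_left_translation cocycle_norm)

lemma rho_bounded: "s \<in> carrier G \<Longrightarrow> rho s \<in> bounded_ops (carrier G)"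
  unfolding rho_def
  by (rule weighted_subst_bounded) (auto simp: bij_right_translation cocycle_norm)

lemma lam_in: "g \<in> carrier G \<Longrightarrow> \<xi> \<in> ell2 (carrier G) \<Longrightarrow> lam g \<xi> \<in> ell2 (carrier G)"
  by (rule bounded_op_in[OF lam_bounded])

lemma rho_in: "g \<in> carrier G \<Longrightarrow> \<xi> \<in> ell2 (carrier G) \<Longrightarrow> rho g \<xi> \<in> ell2 (carrier G)"
  by (rule bounded_op_in[OF rho_bounded])

lemma lam_lam:
  assumes g: "g \<in> carrier G" and h: "h \<in> carrier G" and \<xi>: "\<xi> \<in> ell2 (carrier G)"
  shows "lam g (lam h \<xi>) = (\<lambda>x. \<sigma> g h * lam (g \<otimes> h) \<xi> x)"
proof (rule ell2_eqI)
  fix x assume x: "x \<in> carrier G"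
  define y where "y = inv (g \<otimes> h) \<otimes> x"
  have y: "y \<in> carrier G" "inv g \<otimes> x = h \<otimes> y" "inv h \<otimes> (h \<otimes> y) = y"
    using g h x by (simp_all add: y_def inv_mult_group m_assoc[symmetric])
  have "lam g (lam h \<xi>) x = \<sigma> g (h \<otimes> y) * (\<sigma> h y * \<xi> y)"
    using g h x y \<xi> by (simp add: lam_apply lam_in)
  also have "\<dots> = \<sigma> g h * (\<sigma> (g \<otimes> h) y * \<xi> y)"
    using cocycle_identity[OF g h y(1)] by (simp flip: mult.assoc add: mult.commute)
  also have "\<dots> = \<sigma> g h * lam (g \<otimes> h) \<xi> x"
    using g h x \<xi> by (simp add: lam_apply flip: y_def)
  finally show "lam g (lam h \<xi>) x = \<sigma> g h * lam (g \<otimes> h) \<xi> x" .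
qed (use assms in \<open>auto intro!: lam_in ell2_scale\<close>)

lemma lam_one: "\<xi> \<in> ell2 (carrier G) \<Longrightarrow> lam \<one> \<xi> = \<xi>"
  by (rule ell2_eqI) (auto simp: lam_in lam_apply cocycle_one_left)

lemma lam_rho_commute:
  assumes g: "g \<in> carrier G" and s: "s \<in> carrier G" and \<xi>: "\<xi> \<in> ell2 (carrier G)"
  shows "lam g (rho s \<xi>) = rho s (lam g \<xi>)"
proof (rule ell2_eqI)
  fix x assume x: "x \<in> carrier G"
  define y where "y = inv g \<otimes> x \<otimes> inv s"
  have y: "y \<in> carrier G" "inv g \<otimes> x = y \<otimes> s" "x \<otimes> inv s = g \<otimes> y"
    using g s x by (simp_all add: y_def m_assoc) (simp add: m_assoc[symmetric])
  have "lam g (rho s \<xi>) x = \<sigma> g (y \<otimes> s) * (\<sigma> y s * \<xi> y)"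
    using g s x y \<xi> by (simp add: lam_apply rho_apply rho_in m_assoc)
  also have "\<dots> = \<sigma> (g \<otimes> y) s * (\<sigma> g y * \<xi> y)"
    using cocycle_identity[OF g y(1) s] by (simp flip: mult.assoc add: mult.commute)
  also have "\<dots> = rho s (lam g \<xi>) x"
    using g s x y \<xi> by (simp add: lam_apply rho_apply lam_in m_assoc[symmetric])
  finally show "lam g (rho s \<xi>) x = rho s (lam g \<xi>) x" .
qed (use assms in \<open>auto intro!: lam_in rho_in\<close>)

lemma lam_delta_one: 
  assumes g: "g \<in> carrier G"
  shows "lam g (delta \<one>) = delta g"
proof (rule ell2_eqI)
  fix x assume x: "x \<in> carrier G"
  have "inv g \<otimes> x = \<one> \<longleftrightarrow> x = g"
    using g x by (metis inv_closed inv_inv inv_equality l_inv)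
  then have "delta \<one> (inv g \<otimes> x) = delta g x" by (simp add: delta_def)
  then show "lam g (delta \<one>) x = delta g x"
    using g x by (cases "x = g") (simp_all add: lam_apply ell2_delta cocycle_one_right, simp_all add: delta_def)
qed (use g in \<open>auto intro!: lam_in ell2_delta\<close>)

lemma rho_delta_one: 
  assumes g: "g \<in> carrier G"
  shows "rho g (delta \<one>) = delta g"
proof (rule ell2_eqI)
  fix x assume x: "x \<in> carrier G"
  have "x \<otimes> inv g = \<one> \<longleftrightarrow> x = g"
    using g x by (metis inv_closed inv_inv inv_equality r_inv)
  then have "delta \<one> (x \<otimes> inv g) = delta g x" by (simp add: delta_def)
  then show "rho g (delta \<one>) x = delta g x"
    using g x by (cases "x = g") (simp_all add: rho_apply ell2_delta cocycle_one_left, simp_all add: delta_def)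
qed (use g in \<open>auto intro!: rho_in ell2_delta\<close>)

lemma 
  assumes g: "g \<in> carrier G"
  shows lam_unitary: "unitary_op (carrier G) (lam g)"
    and lam_adjoint: "op_adjoint (carrier G) (lam g) = op_scale (carrier G) (cnj (\<sigma> g (inv g))) (lam (inv g))"
proof -
  let ?A = "carrier G" and ?W = "op_scale (carrier G) (cnj (\<sigma> g (inv g))) (lam (inv g))"
  have iso: "ell2_inner ?A (lam g \<xi>) (lam g \<eta>) = ell2_inner ?A \<xi> \<eta>"
    if "\<xi> \<in> ell2 ?A" "\<eta> \<in> ell2 ?A" for \<xi> \<eta>
    unfolding lam_weighted_subst
    by (rule weighted_subst_isometric) (use g that in \<open>auto simp: bij_left_translation cocycle_norm\<close>)
  have right: "lam g (?W \<xi>) = \<xi>" if "\<xi> \<in> ell2 ?A" for \<xi>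
    using g that by (simp add: op_apply bounded_op_scale[OF lam_bounded] lam_in lam_lam lam_one 
        cocycle_mult_cnj flip: mult.assoc)
  have left: "?W (lam g \<xi>) = \<xi>" if "\<xi> \<in> ell2 ?A" for \<xi>
    using g that by (simp add: op_apply lam_in lam_lam lam_one cocycle_inv_commute
        cocycle_mult_cnj flip: mult.assoc)
  show "unitary_op ?A (lam g)" "op_adjoint ?A (lam g) = ?W"
    by (rule unitaryI[OF lam_bounded[OF g] op_scale_bounded[OF lam_bounded] iso right left]; use g in simp)+
qed

lemma lam_conj:
  assumes g: "g \<in> carrier G" and h: "h \<in> carrier G"
  shows "op_conj (carrier G) (lam g) (lam h) =
    op_scale (carrier G) (\<sigma> g h * cnj (\<sigma> (g \<otimes> h \<otimes> inv g) g)) (lam (g \<otimes> h \<otimes> inv g))"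
proof (rule op_conj_eqI[OF lam_unitary[OF g]])
  fix \<xi> assume \<xi>: "\<xi> \<in> ell2 (carrier G)"
  let ?k = "g \<otimes> h \<otimes> inv g"
  have k: "?k \<in> carrier G" "?k \<otimes> g = g \<otimes> h" using g h by (simp_all add: m_assoc)
  have "op_scale (carrier G) (\<sigma> g h * cnj (\<sigma> ?k g)) (lam ?k) (lam g \<xi>) = 
      (\<lambda>x. \<sigma> g h * (cnj (\<sigma> ?k g) * \<sigma> ?k g) * lam (?k \<otimes> g) \<xi> x)"
    using g k(1) \<xi> by (simp add: op_apply lam_in lam_lam ac_simps)
  also have "\<dots> = lam g (lam h \<xi>)"
    using g h k \<xi> by (simp add: cocycle_mult_cnj lam_lam)
  finally show "lam g (lam h \<xi>) = op_scale (carrier G) (\<sigma> g h * cnj (\<sigma> ?k g)) (lam ?k) (lam g \<xi>)" ..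
qed (use g h in \<open>auto intro!: op_scale_bounded lam_bounded\<close>)

end

section \<open>The von Neumann algebra of a normal subgroup\<close>

locale twisted_normal = normal H G + twisted_group G \<sigma>
  for H and G (structure) and \<sigma>
begin

abbreviation "M \<equiv> twisted_vN G H \<sigma>"
abbreviation "B \<equiv> bounded_ops (carrier G)"

lemma H_in_carrier: "h \<in> H \<Longrightarrow> h \<in> carrier G"
  using subset by blast

lemma lam_H_bounded: "lam ` H \<subseteq> B"
  by (auto intro: lam_bounded H_in_carrier)

lemma commutant_lam_H_bounded: "commutant (carrier G) (lam ` H) \<subseteq> B"
  by (auto dest: commutant_bounded)

lemma scaled_lam_in_double_commutant:
  "h \<in> H \<Longrightarrow> op_scale (carrier G) c (lam h) \<in> commutant (carrier G) (commutant (carrier G) (lam ` H))"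
  by (intro commutant_scale commutant_lam_H_bounded subsetD[OF double_commutant_extensive[OF lam_H_bounded]]) simp

lemma lam_H_adjoint:
  assumes "S \<in> lam ` H"
  shows "op_adjoint (carrier G) S \<in> commutant (carrier G) (commutant (carrier G) (lam ` H))"
  using assms by (auto simp: lam_adjoint H_in_carrier intro!: scaled_lam_in_double_commutant)

lemma M_eq: "M = commutant (carrier G) (commutant (carrier G) (lam ` H))"
  unfolding twisted_vN_def
  by (rule vN_generated_eq_double_commutant[OF lam_H_bounded lam_H_adjoint])

lemma M_bounded: "T \<in> M \<Longrightarrow> T \<in> B"
  unfolding M_eq by (rule commutant_bounded)

lemma scaled_lam_in_M: "h \<in> H \<Longrightarrow> op_scale (carrier G) c (lam h) \<in> M"
  unfolding M_eq by (rule scaled_lam_in_double_commutant)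

lemma lam_in_M: "h \<in> H \<Longrightarrow> lam h \<in> M"
  unfolding M_eq using double_commutant_extensive[OF lam_H_bounded] by blast

lemma M_adjoint: "T \<in> M \<Longrightarrow> op_adjoint (carrier G) T \<in> M"
  unfolding M_eq
proof (rule commutant_adjoint[OF commutant_lam_H_bounded])
  fix S assume S: "S \<in> commutant (carrier G) (lam ` H)"
  have "op_adjoint (carrier G) S \<in> commutant (carrier G) (lam ` H)"
    by (rule commutant_adjoint[OF lam_H_bounded _ S], rule lam_H_adjoint)
  then show "op_adjoint (carrier G) S \<in> 
      commutant (carrier G) (commutant (carrier G) (commutant (carrier G) (lam ` H)))"
    by (simp add: triple_commutant lam_H_bounded)
qed

lemma M_add: "S \<in> M \<Longrightarrow> T \<in> M \<Longrightarrow> op_add (carrier G) S T \<in> M"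
  unfolding M_eq by (rule commutant_add[OF commutant_lam_H_bounded])

lemma M_mult: "S \<in> M \<Longrightarrow> T \<in> M \<Longrightarrow> op_mult (carrier G) S T \<in> M"
  unfolding M_eq by (rule commutant_mult[OF commutant_lam_H_bounded])

lemma M_scale: "T \<in> M \<Longrightarrow> op_scale (carrier G) c T \<in> M"
  unfolding M_eq by (rule commutant_scale[OF commutant_lam_H_bounded])

lemma conj_in_M:
  assumes g: "g \<in> carrier G" and T: "T \<in> M"
  shows "op_conj (carrier G) (lam g) T \<in> M"
  using T unfolding M_eq
proof (rule op_conj_double_commutant[OF lam_unitary[OF g] lam_H_bounded, rotated])
  fix S assume "S \<in> lam ` H"
  then show "op_conj (carrier G) (lam g) S \<in> commutant (carrier G) (commutant (carrier G) (lam ` H))"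
    using g by (auto simp: lam_conj H_in_carrier inv_op_closed2 intro!: scaled_lam_in_double_commutant)
qed

lemma gamma_automorphism:
  assumes g: "g \<in> carrier G"
  shows "vN_automorphism (carrier G) M (gamma_aut G H \<sigma> g)"
  unfolding gamma_aut_def
proof (rule op_conj_automorphism[OF lam_unitary[OF g]])
  fix T assume T: "T \<in> M"
  have "op_conj (carrier G) (op_adjoint (carrier G) (lam g)) T = op_conj (carrier G) (lam (inv g)) T"
    using g by (simp add: lam_adjoint op_conj_scale_left cocycle_norm lam_bounded M_bounded[OF T])
  then show "op_conj (carrier G) (op_adjoint (carrier G) (lam g)) T \<in> M"
    using conj_in_M[of "inv g", OF _ T] g by simp
qed (use g in \<open>auto intro: M_bounded M_adjoint conj_in_M M_mult M_add M_scale\<close>)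

lemma gamma_apply: "T \<in> M \<Longrightarrow> gamma_aut G H \<sigma> g T = op_conj (carrier G) (lam g) T"
  by (simp add: gamma_aut_def)


section \<open>Freeness of the conjugation automorphisms\<close>

text \<open>The algebra is a double commutant, and the right translations commute with its generators.\<close>

lemma M_commutes_rho:
  assumes "T \<in> M" "s \<in> carrier G" "\<xi> \<in> ell2 (carrier G)"
  shows "T (rho s \<xi>) = rho s (T \<xi>)"
proof -
  have "rho s \<in> commutant (carrier G) (lam ` H)"
    using assms(2) by (auto intro!: commutantI rho_bounded simp: lam_rho_commute H_in_carrier)
  then show ?thesis
    using assms commutantD[of T] unfolding M_eq by metis
qed

text \<open>The projection \<open>P\<close> onto the functions supported in \<open>H\<close> commutes with left translations by
  elements of \<open>H\<close>, hence with the whole algebra.\<close>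

lemma M_delta_one_support:
  assumes T: "T \<in> M" and x: "x \<in> carrier G" "x \<notin> H"
  shows "T (delta \<one>) x = 0"
proof -
  let ?A = "carrier G"
  define P where "P = weighted_subst ?A (\<lambda>x. if x \<in> H then 1 else 0) (\<lambda>x. x)"
  have P_bd: "P \<in> B"
    unfolding P_def by (rule weighted_subst_bounded) (auto simp: bij_betw_def)
  have P: "P \<xi> x = (if x \<in> H then \<xi> x else 0)" if "\<xi> \<in> ell2 ?A" for \<xi> x
    using that H_in_carrier by (auto simp: P_def weighted_subst_def)
  have "P \<in> commutant ?A (lam ` H)"
  proof (rule commutantI[OF P_bd], elim imageE, hypsubst)
    fix h \<xi> assume h: "h \<in> H" and \<xi>: "\<xi> \<in> ell2 ?A"
    have hG: "h \<in> ?A" using h by (rule H_in_carrier)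
    show "lam h (P \<xi>) = P (lam h \<xi>)"
    proof (rule ell2_eqI)
      fix x assume x: "x \<in> ?A"
      have "inv h \<otimes> x \<in> H \<longleftrightarrow> x \<in> H"
      proof
        assume "inv h \<otimes> x \<in> H"
        then have "h \<otimes> (inv h \<otimes> x) \<in> H" using h by blast
        then show "x \<in> H" using hG x by (simp flip: m_assoc)
      qed (use h in auto)
      then show "lam h (P \<xi>) x = P (lam h \<xi>) x"
        using x hG \<xi> by (simp add: P lam_apply lam_in bounded_op_in[OF P_bd])
    qed (use hG \<xi> in \<open>auto intro!: lam_in bounded_op_in[OF P_bd]\<close>)
  qed
  then have "P (T (delta \<one>)) = T (P (delta \<one>))"
    using T ell2_delta[of \<one> ?A] unfolding M_eq by (intro commutantD) auto
  also have "P (delta \<one>) = delta \<one>"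
    by (rule ext) (simp add: P ell2_delta, simp add: delta_def)
  finally have "T (delta \<one>) x = P (T (delta \<one>)) x" by simp
  then show ?thesis
    using x by (simp add: P bounded_op_in[OF M_bounded[OF T]] ell2_delta)
qed

text \<open>The vector \<open>delta \<one>\<close> is separating: right translations carry it to every point mass and commute
  with \<open>T\<close>.\<close>

lemma M_eq_zeroI:
  assumes T: "T \<in> M" and zero: "T (delta \<one>) = (\<lambda>x. 0)"
  shows "T = op_zero (carrier G)"
proof (rule op_eq_deltaI[OF M_bounded[OF T] op_zero_bounded])
  fix x assume x: "x \<in> carrier G"
  have "T (delta x) = rho x (T (delta \<one>))"
    using M_commutes_rho[OF T x, of "delta \<one>"] x by (simp add: rho_delta_one ell2_delta)
  then show "T (delta x) = op_zero (carrier G) (delta x)"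
    using x by (simp add: zero bounded_op_zero_vector[OF rho_bounded] op_zero_apply ell2_delta)
qed

text \<open>Evaluating the equation at \<open>s \<otimes> x\<close> compares \<open>v\<close> at \<open>x\<close> and at its conjugate by \<open>s\<close>.  If \<open>s\<close>
  commutes with \<open>x\<close>, this reads \<open>\<sigma> s x * v x = \<sigma> x s * v x\<close>, which forces \<open>v x = 0\<close> when \<open>x\<close> is not
  regular.  If \<open>x\<close> is regular, taking absolute values shows that \<open>\<bar>v\<bar>\<close> is constant on the class of
  \<open>x\<close>, which is infinite by the Kleppner condition, and a square-summable function cannot take a
  nonzero constant absolute value infinitely often.\<close>

lemma twisted_class_function_vanishes:
  assumes kleppner: "relative_kleppner G H \<sigma>" 
    and v: "v \<in> ell2 (carrier G)" and eq: "\<And>s. s \<in> H \<Longrightarrow> lam s v = rho s v"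
    and x: "x \<in> carrier G" "x \<notin> H"
  shows "v x = 0"
proof -
  have conj: "\<sigma> s x * v x = \<sigma> (s \<otimes> x \<otimes> inv s) s * v (s \<otimes> x \<otimes> inv s)" if s: "s \<in> H" for s
  proof -
    have sG: "s \<in> carrier G" using s by (rule H_in_carrier)
    have "lam s v (s \<otimes> x) = rho s v (s \<otimes> x)" using eq[OF s] by simp
    then show ?thesis
      using sG x v by (simp add: lam_apply rho_apply flip: m_assoc)
  qed
  show ?thesis
  proof (cases "sigma_regular G H \<sigma> x")
    case False
    then obtain s where s: "s \<in> H" "s \<otimes> x = x \<otimes> s" "\<sigma> x s \<noteq> \<sigma> s x"
      by (auto simp: sigma_regular_def)
    have "s \<otimes> x \<otimes> inv s = x"
      using s(2) x H_in_carrier[OF s(1)] by (simp add: m_assoc)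
    then show ?thesis using conj[OF s(1)] s(3) by auto
  next
    case True
    let ?C = "rel_conj_class G H x" and ?f = "\<lambda>y. (cmod (v y))\<^sup>2"
    have inf: "infinite ?C"
      using kleppner True x by (simp add: relative_kleppner_def)
    have C: "?C \<subseteq> carrier G"
      using x H_in_carrier by (auto simp: rel_conj_class_def)
    have const: "cmod (v y) = cmod (v x)" if y: "y \<in> ?C" for y
    proof -
      obtain s where s: "s \<in> H" "y = s \<otimes> x \<otimes> inv s"
        using y by (auto simp: rel_conj_class_def)
      have "cmod (\<sigma> s x * v x) = cmod (\<sigma> y s * v y)"
        using conj[OF s(1)] s(2) by simp
      then show ?thesis
        using s x H_in_carrier[OF s(1)] by (simp add: norm_mult cocycle_norm)
    qed
    have "?f summable_on ?C"
      using summable_on_subset_banach[OF ell2_summable[OF v] C] .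
    then have "(\<lambda>y. (cmod (v x))\<^sup>2) summable_on ?C"
      by (rule summable_on_cong[THEN iffD1, rotated]) (simp add: const)
    then show ?thesis
      using infsum_diverge_constant[OF inf, of "(cmod (v x))\<^sup>2"] by auto
  qed
qed

text \<open>An intertwiner \<open>T\<close> becomes, after multiplication by the adjoint of \<open>lam k\<close>, an operator \<open>V\<close>
  that commutes with \<open>lam h\<close> for \<open>h \<in> H\<close> and with all right translations.  Both \<open>lam h\<close> and
  \<open>rho h\<close> send \<open>delta \<one>\<close> to \<open>delta h\<close>, so \<open>v = V (delta \<one>)\<close> satisfies \<open>lam h v = rho h v\<close> and
  vanishes off \<open>H\<close> by the preceding lemma.  It vanishes on \<open>H\<close> too: as \<open>T (delta \<one>)\<close> is supported
  in \<open>H\<close>, its translate \<open>v\<close> is supported in the left coset of \<open>inv k\<close>, which is disjoint from \<open>H\<close>.\<close>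

lemma gamma_freely_acting:
  assumes kleppner: "relative_kleppner G H \<sigma>" and k: "k \<in> carrier G" "k \<notin> H"
  shows "freely_acting (carrier G) M (gamma_aut G H \<sigma> k)"
  unfolding freely_acting_def
proof (intro conjI gamma_automorphism k ballI impI)
  let ?A = "carrier G" and ?U' = "op_adjoint (carrier G) (lam k)"
  fix T assume T: "T \<in> M" and intertwines: "\<forall>S\<in>M. op_mult ?A (gamma_aut G H \<sigma> k S) T = op_mult ?A T S"
  note T_in = bounded_op_in[OF M_bounded[OF T]]
  have d: "delta \<one> \<in> ell2 ?A" by (simp add: ell2_delta)
  have U'_in: "?U' \<xi> \<in> ell2 ?A" if "\<xi> \<in> ell2 ?A" for \<xi>
    using that k by (intro bounded_op_in[OF op_adjoint_bounded[OF lam_bounded]])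
  have U': "?U' \<xi> = (\<lambda>x. cnj (\<sigma> k (inv k)) * lam (inv k) \<xi> x)" if "\<xi> \<in> ell2 ?A" for \<xi>
    using that k by (simp add: lam_adjoint op_scale_apply)
  define V where "V \<xi> = ?U' (T \<xi>)" for \<xi>
  (* Multiply the intertwining relation for S = lam h by the adjoint of lam k. *)
  have V_lam: "V (lam h \<xi>) = lam h (V \<xi>)" if h: "h \<in> H" and \<xi>: "\<xi> \<in> ell2 ?A" for h \<xi>
  proof -
    have "op_mult ?A (op_conj ?A (lam k) (lam h)) T \<xi> = op_mult ?A T (lam h) \<xi>"
      using intertwines lam_in_M[OF h] by (metis gamma_apply)
    then have "lam k (lam h (V \<xi>)) = T (lam h \<xi>)"
      using \<xi> k by (simp add: op_mult_apply op_conj_apply lam_bounded T_in V_def)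
    then show ?thesis
      using unitary_adjoint_left[OF lam_unitary[OF k(1)], of "lam h (V \<xi>)"] \<xi> h
      by (simp add: V_def U'_in T_in lam_in H_in_carrier)
  qed
  have V_rho: "V (rho s \<xi>) = rho s (V \<xi>)" if s: "s \<in> ?A" and \<xi>: "\<xi> \<in> ell2 ?A" for s \<xi>
    using s \<xi> k by (simp add: V_def M_commutes_rho[OF T] U' T_in rho_in lam_rho_commute 
        bounded_op_scale[OF rho_bounded] lam_in)
  define v where "v = V (delta \<one>)"
  have v_in: "v \<in> ell2 ?A" unfolding v_def V_def by (intro U'_in T_in d)
  have class_function: "lam s v = rho s v" if s: "s \<in> H" for s
    using V_lam[OF s d] V_rho[OF H_in_carrier[OF s] d] H_in_carrier[OF s]
    by (simp add: v_def lam_delta_one rho_delta_one)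
  have "v = (\<lambda>x. 0)"
  proof (rule ell2_eqI[OF v_in ell2_zero])
    fix x assume x: "x \<in> ?A"
    show "v x = 0"
    proof (cases "x \<in> H")
      case False
      then show ?thesis
        using twisted_class_function_vanishes[OF kleppner v_in class_function x] by blast
    next
      case True
      have "k \<otimes> x \<notin> H"
      proof
        assume "k \<otimes> x \<in> H"
        then have "k \<otimes> x \<otimes> inv x \<in> H" using True by blast
        then show False using k x by (simp add: m_assoc)
      qed
      then have "T (delta \<one>) (k \<otimes> x) = 0"
        using M_delta_one_support[OF T] k x by simp
      then show ?thesis
        using k x by (simp add: v_def V_def U' T_in d lam_apply)
    qed
  qed
  then have "T (delta \<one>) = lam k (\<lambda>x. 0)"
    using unitary_adjoint_right[OF lam_unitary[OF k(1)] T_in[OF d]] by (simp add: v_def V_def)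
  then show "T = op_zero ?A"
    using k by (intro M_eq_zeroI T) (simp add: bounded_op_zero_vector[OF lam_bounded])
qed

section \<open>The twisted action of the quotient group\<close>

lemma scaled_lam_unitary:
  assumes h: "h \<in> H" and c: "cmod c = 1"
  shows "vN_unitary (carrier G) M (op_scale (carrier G) c (lam h))"
proof -
  let ?A = "carrier G" and ?U = "op_scale (carrier G) c (lam h)"
  note hG = H_in_carrier[OF h]
  note U = lam_unitary[OF hG] 
  have cc: "c * cnj c = 1" "cnj c * c = 1" using c by (simp_all flip: complex_norm_square add: mult.commute)
  have adj: "op_adjoint ?A ?U = op_scale ?A (cnj c) (op_adjoint ?A (lam h))"
    using hG by (simp add: op_adjoint_scale lam_bounded)
  have bd: "lam h \<in> B" "op_adjoint ?A (lam h) \<in> B" using hG by (auto intro: lam_bounded op_adjoint_bounded)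
  have "op_mult ?A (op_adjoint ?A ?U) ?U = op_one ?A" "op_mult ?A ?U (op_adjoint ?A ?U) = op_one ?A"
    unfolding adj using bd cc
    by (auto intro!: op_eqI[of _ ?A] op_bounded simp: op_apply bounded_op_scale bounded_op_in ell2_scale
        unitary_adjoint_left[OF U] unitary_adjoint_right[OF U] simp flip: mult.assoc)
  then show ?thesis
    using scaled_lam_in_M[OF h] by (simp add: vN_unitary_def)
qed


context
  fixes s :: "'a set \<Rightarrow> 'a"
  assumes is_section: "normalized_section G H s"
begin

(* The facts about the section speak of products and the identity of the quotient group, which
   these rules would turn into set products and H. *)
declare mult_FactGroup [simp del] one_FactGroup [simp del]

lemma section_closed: "k \<in> carrier (G Mod H) \<Longrightarrow> s k \<in> carrier G"
  using is_section by (simp add: normalized_section_def)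

lemma section_coset: "k \<in> carrier (G Mod H) \<Longrightarrow> H #> s k = k"
  using is_section by (simp add: normalized_section_def)

lemma section_one: "s \<one>\<^bsub>G Mod H\<^esub> = \<one>"
  using is_section by (simp add: normalized_section_def)

lemma quotient_group: "group (G Mod H)"
  by (rule factorgroup_is_group)

lemma quotient_closed: 
  "k \<in> carrier (G Mod H) \<Longrightarrow> l \<in> carrier (G Mod H) \<Longrightarrow> k \<otimes>\<^bsub>G Mod H\<^esub> l \<in> carrier (G Mod H)"
  by (rule monoid.m_closed[OF group.is_monoid[OF quotient_group]])

lemma section_defect_in_H:
  assumes k: "k \<in> carrier (G Mod H)" and l: "l \<in> carrier (G Mod H)"
  shows "section_defect G H s k l \<in> H"
proof -
  let ?kl = "k \<otimes>\<^bsub>G Mod H\<^esub> l"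
  note closed = section_closed[OF k] section_closed[OF l] section_closed[OF quotient_closed[OF k l]]
  have "?kl = (H #> s k) <#> (H #> s l)"
    using k l by (simp add: section_coset mult_FactGroup)
  then have "H #> s ?kl = H #> (s k \<otimes> s l)"
    using rcos_sum[OF closed(1,2)] section_coset[OF quotient_closed[OF k l]] by simp
  then have "s k \<otimes> s l \<in> H #> s ?kl"
    using rcos_self[OF m_closed[OF closed(1,2)]] is_subgroup by simp
  then show ?thesis
    unfolding section_defect_def using rcos_module[OF is_group closed(3)] closed by simp
qed

lemma omega_unitary:
  assumes k: "k \<in> carrier (G Mod H)" and l: "l \<in> carrier (G Mod H)"
  shows "vN_unitary (carrier G) M (quotient_omega G H \<sigma> s k l)"
  unfolding quotient_omega_def
  using k l section_defect_in_H[OF k l]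
  by (intro scaled_lam_unitary) 
    (simp_all add: norm_mult cocycle_norm section_closed quotient_closed H_in_carrier)

lemma omega_in_M:
  "k \<in> carrier (G Mod H) \<Longrightarrow> l \<in> carrier (G Mod H) \<Longrightarrow> quotient_omega G H \<sigma> s k l \<in> M"
  using omega_unitary by (simp add: vN_unitary_def)

text \<open>The operator \<open>\<omega> k l\<close> measures the failure of \<open>k \<mapsto> lam (s k)\<close> to be multiplicative.  Both axioms
  relating \<open>\<beta>\<close> and \<open>\<omega>\<close> follow from this by applying the two sides to vectors of the form \<open>lam g \<zeta>\<close>
  and cancelling.\<close>

lemma omega_lam:
  assumes k: "k \<in> carrier (G Mod H)" and l: "l \<in> carrier (G Mod H)" and \<xi>: "\<xi> \<in> ell2 (carrier G)"
  shows "quotient_omega G H \<sigma> s k l (lam (s (k \<otimes>\<^bsub>G Mod H\<^esub> l)) \<xi>) = lam (s k) (lam (s l) \<xi>)"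
proof -
  let ?kl = "k \<otimes>\<^bsub>G Mod H\<^esub> l" and ?m = "section_defect G H s k l"
  note closed = section_closed[OF k] section_closed[OF l] section_closed[OF quotient_closed[OF k l]]
    H_in_carrier[OF section_defect_in_H[OF k l]]
  have prod: "?m \<otimes> s ?kl = s k \<otimes> s l"
    unfolding section_defect_def using closed by (simp add: m_assoc)
  have "quotient_omega G H \<sigma> s k l (lam (s ?kl) \<xi>) =
      (\<lambda>x. \<sigma> (s k) (s l) * (cnj (\<sigma> ?m (s ?kl)) * \<sigma> ?m (s ?kl)) * lam (?m \<otimes> s ?kl) \<xi> x)"
    using closed \<xi> by (simp add: quotient_omega_def op_scale_apply lam_in lam_lam ac_simps)
  also have "\<dots> = lam (s k) (lam (s l) \<xi>)"
    using closed \<xi> by (simp add: cocycle_mult_cnj lam_lam prod)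
  finally show ?thesis .
qed

lemma omega_conjugation:
  assumes k: "k \<in> carrier (G Mod H)" and l: "l \<in> carrier (G Mod H)" and T: "T \<in> M"
  shows "quotient_beta G H \<sigma> s k (quotient_beta G H \<sigma> s l T) =
    op_conj (carrier G) (quotient_omega G H \<sigma> s k l) (quotient_beta G H \<sigma> s (k \<otimes>\<^bsub>G Mod H\<^esub> l) T)"
proof -
  let ?A = "carrier G" and ?\<omega> = "quotient_omega G H \<sigma> s k l" and ?g = "s (k \<otimes>\<^bsub>G Mod H\<^esub> l)"
  note closed = section_closed[OF k] section_closed[OF l] section_closed[OF quotient_closed[OF k l]]
  let ?L = "op_conj ?A (lam (s k)) (op_conj ?A (lam (s l)) T)"
  note T_bd = M_bounded[OF T]
  have omega: "unitary_op ?A ?\<omega>"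
    using omega_unitary[OF k l] M_bounded by (auto simp: vN_unitary_def)
  have "op_conj ?A ?\<omega> (op_conj ?A (lam ?g) T) = ?L"
  proof (rule op_conj_eqI[OF omega])
    fix \<xi> assume \<xi>: "\<xi> \<in> ell2 ?A"
    define \<zeta> where "\<zeta> = op_adjoint ?A (lam ?g) \<xi>"
    have \<zeta>: "\<zeta> \<in> ell2 ?A" 
      unfolding \<zeta>_def by (rule bounded_op_in[OF op_adjoint_bounded[OF lam_bounded[OF closed(3)]] \<xi>])
    have \<xi>_eq: "\<xi> = lam ?g \<zeta>" 
      unfolding \<zeta>_def using unitary_adjoint_right[OF lam_unitary[OF closed(3)] \<xi>] by simp
    show "?\<omega> (op_conj ?A (lam ?g) T \<xi>) = ?L (?\<omega> \<xi>)"
      unfolding \<xi>_eq using \<zeta> closed k l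
      by (simp add: op_conj_apply lam_bounded lam_in omega_lam bounded_op_in[OF T_bd] 
          unitary_adjoint_left[OF lam_unitary])
  qed (intro op_conj_bounded lam_bounded closed T_bd)+
  then show ?thesis
    using closed T by (simp add: quotient_beta_def gamma_apply conj_in_M)
qed

lemma omega_cocycle:
  assumes k: "k \<in> carrier (G Mod H)" and l: "l \<in> carrier (G Mod H)" and j: "j \<in> carrier (G Mod H)"
  shows "op_mult (carrier G) (quotient_omega G H \<sigma> s k l) (quotient_omega G H \<sigma> s (k \<otimes>\<^bsub>G Mod H\<^esub> l) j) =
    op_mult (carrier G) (quotient_beta G H \<sigma> s k (quotient_omega G H \<sigma> s l j))
      (quotient_omega G H \<sigma> s k (l \<otimes>\<^bsub>G Mod H\<^esub> j))"
proof -
  let ?A = "carrier G" and ?\<omega> = "quotient_omega G H \<sigma> s"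
  let ?kl = "k \<otimes>\<^bsub>G Mod H\<^esub> l" and ?lj = "l \<otimes>\<^bsub>G Mod H\<^esub> j"
  have kl: "?kl \<in> carrier (G Mod H)" and lj: "?lj \<in> carrier (G Mod H)"
    using k l j by (auto intro: quotient_closed)
  define g where "g = s (?kl \<otimes>\<^bsub>G Mod H\<^esub> j)"
  have g: "g \<in> ?A" unfolding g_def by (intro section_closed quotient_closed k l j)
  have assoc: "?kl \<otimes>\<^bsub>G Mod H\<^esub> j = k \<otimes>\<^bsub>G Mod H\<^esub> ?lj"
    using monoid.m_assoc[OF group.is_monoid[OF quotient_group] k l j] .
  note closed = section_closed[OF k] section_closed[OF l] section_closed[OF j]
    section_closed[OF kl] section_closed[OF lj]
  have bd: "?\<omega> k l \<in> B" "?\<omega> ?kl j \<in> B" "?\<omega> l j \<in> B" "?\<omega> k ?lj \<in> B"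
    by (intro M_bounded omega_in_M k l j kl lj)+
  have "op_mult ?A (?\<omega> k l) (?\<omega> ?kl j) = op_mult ?A (op_conj ?A (lam (s k)) (?\<omega> l j)) (?\<omega> k ?lj)"
  proof (rule op_eqI)
    fix \<xi> assume \<xi>: "\<xi> \<in> ell2 ?A"
    define \<zeta> where "\<zeta> = op_adjoint ?A (lam g) \<xi>"
    have \<zeta>: "\<zeta> \<in> ell2 ?A" 
      unfolding \<zeta>_def by (rule bounded_op_in[OF op_adjoint_bounded[OF lam_bounded[OF g]] \<xi>])
    have \<xi>_eq: "\<xi> = lam g \<zeta>" 
      unfolding \<zeta>_def using unitary_adjoint_right[OF lam_unitary[OF g] \<xi>] by simp
    have "?\<omega> k l (?\<omega> ?kl j \<xi>) = lam (s k) (lam (s l) (lam (s j) \<zeta>))"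
      unfolding \<xi>_eq g_def using \<zeta> closed k l j kl by (simp add: omega_lam lam_in)
    moreover have "op_conj ?A (lam (s k)) (?\<omega> l j) (?\<omega> k ?lj \<xi>) = lam (s k) (lam (s l) (lam (s j) \<zeta>))"
      unfolding \<xi>_eq g_def assoc using \<zeta> closed k l j lj 
      by (simp add: omega_lam lam_in op_conj_apply lam_bounded unitary_adjoint_left[OF lam_unitary])
    ultimately show "op_mult ?A (?\<omega> k l) (?\<omega> ?kl j) \<xi> = 
        op_mult ?A (op_conj ?A (lam (s k)) (?\<omega> l j)) (?\<omega> k ?lj) \<xi>"
      using \<xi> by (simp add: op_mult_apply)
  qed (intro op_mult_bounded op_conj_bounded lam_bounded closed bd)+
  then show ?thesis
    using omega_in_M[OF l j] by (simp add: quotient_beta_def gamma_apply)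
qed

lemma omega_one:
  assumes k: "k \<in> carrier (G Mod H)"
  shows "quotient_omega G H \<sigma> s k \<one>\<^bsub>G Mod H\<^esub> = op_one (carrier G)"
    and "quotient_omega G H \<sigma> s \<one>\<^bsub>G Mod H\<^esub> k = op_one (carrier G)"
proof -
  interpret K: group "G Mod H" by (rule quotient_group)
  have scale_lam_one: "op_scale (carrier G) 1 (lam \<one>) = op_one (carrier G)"
    by (rule op_eqI[of _ "carrier G"]) 
      (auto intro!: op_bounded lam_bounded simp: op_apply lam_one)
  show "quotient_omega G H \<sigma> s k \<one>\<^bsub>G Mod H\<^esub> = op_one (carrier G)"
    using K.r_one[OF k] section_closed[OF k] scale_lam_one unfolding quotient_omega_def section_defect_def
    by (simp add: section_one cocycle_one_right cocycle_one_left)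
  show "quotient_omega G H \<sigma> s \<one>\<^bsub>G Mod H\<^esub> k = op_one (carrier G)"
    using K.l_one[OF k] section_closed[OF k] scale_lam_one unfolding quotient_omega_def section_defect_def
    by (simp add: section_one cocycle_one_right cocycle_one_left)
qed

lemma section_twisted_action:
  "twisted_action (G Mod H) (carrier G) M (quotient_beta G H \<sigma> s) (quotient_omega G H \<sigma> s)"
  unfolding twisted_action_def
proof (intro conjI ballI)
  fix k assume "k \<in> carrier (G Mod H)"
  then show "vN_automorphism (carrier G) M (quotient_beta G H \<sigma> s k)"
    unfolding quotient_beta_def by (intro gamma_automorphism section_closed)
qed (fact omega_unitary omega_conjugation omega_cocycle omega_one)+

lemma section_freely_acting:
  assumes "relative_kleppner G H \<sigma>"
  shows "freely_acting_twisted (G Mod H) (carrier G) M (quotient_beta G H \<sigma> s) (quotient_omega G H \<sigma> s)"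
  unfolding freely_acting_twisted_def
proof (intro conjI section_twisted_action ballI)
  fix k assume k: "k \<in> carrier (G Mod H) - {\<one>\<^bsub>G Mod H\<^esub>}"
  have "s k \<notin> H"
  proof
    assume "s k \<in> H"
    then have "H #> s k = H" using is_group by (rule rcos_const[rotated])
    then show False using k section_coset by (simp add: one_FactGroup)
  qed
  then show "freely_acting (carrier G) M (quotient_beta G H \<sigma> s k)"
    unfolding quotient_beta_def using k by (intro gamma_freely_acting assms section_closed) auto
qed

end

end

theorem proposition4p7:
  fixes G :: "('a, 'b) monoid_scheme"
    and H :: "'a set"
    and \<sigma> :: "'a \<Rightarrow> 'a \<Rightarrow> complex"
  assumes "group G"
    and "H \<lhd> G"
    and "\<sigma> \<in> cocycles G"
    and "relative_kleppner G H \<sigma>"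
  shows "(\<forall>k\<in>carrier G - H.
            freely_acting (carrier G) (twisted_vN G H \<sigma>) (gamma_aut G H \<sigma> k)) \<and>
         (\<forall>s. normalized_section G H s \<longrightarrow>
            freely_acting_twisted (G Mod H) (carrier G) (twisted_vN G H \<sigma>)
              (quotient_beta G H \<sigma> s) (quotient_omega G H \<sigma> s))"
proof -
  interpret twisted_normal H G \<sigma>
    using assms by (intro twisted_normal.intro twisted_group.intro twisted_group_axioms.intro)
  show ?thesis
    using gamma_freely_acting[OF assms(4)] section_freely_acting[OF _ assms(4)] by blast
qed

end
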